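(* Let $p$ be an odd prime and $D_{2p}=\langle \tau,\sigma\mid \tau^p=\sigma^2=e,\ \sigma\tau\sigma=\tau^{-1}\rangle$. The number of Cayley graphs on $D_{2p}$ up to isomorphism (i.e. isomorphism classes of $\mathrm{Cay}(D_{2p},S)$ with $S\subseteq D_{2p}\setminus\{e\}$, $S=S^{-1}$) is $$\mathcal{N}'=\frac{1}{p}\left(2^{\frac{p+1}{2}}-2^{\frac{3p-1}{2}}\right)+\frac{2}{p-1}\sum_{i=0}^{p-2}2^{\frac{\gcd(2i,p-1)}{2}+\gcd(i,p-1)}.$$
   Context: For a finite group $G$ and $S\subseteq G$ with $e\notin S$ and $S^{-1}=\{s^{-1}\mid s\in S\}=S$, the Cayley graph $\mathrm{Cay}(G,S)$ is the undirected graph with vertex set $G$ in which $g,h$ are adjacent whenever $hg^{-1}\in S$. Here $\gcd(0,p-1)=p-1$. *)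

theory Defs
  imports
    "Graph_Theory.Graph_Theory"
    "HOL-Computational_Algebra.Primes"
    "HOL-Algebra.Group"
begin

section \<open>Groups given by generators and relations\<close>

text \<open>
  The generators are all elements of the type \<open>'a\<close>. The letter \<open>(x, True)\<close> stands for the
  generator \<open>x\<close> and \<open>(x, False)\<close> for its formal inverse; a pair \<open>(l, r)\<close> of words stands for the
  relation \<open>l = r\<close>.
\<close>

type_synonym 'a gword = "('a \<times> bool) list"

inductive pres_eq :: "('a gword \<times> 'a gword) set \<Rightarrow> 'a gword \<Rightarrow> 'a gword \<Rightarrow> bool"
  for R :: "('a gword \<times> 'a gword) set" where
  pres_refl: "pres_eq R w w"
| pres_sym: "pres_eq R v w \<Longrightarrow> pres_eq R w v"
| pres_trans: "pres_eq R u v \<Longrightarrow> pres_eq R v w \<Longrightarrow> pres_eq R u w"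
| pres_cancel: "pres_eq R (u @ [(x, b), (x, \<not> b)] @ v) (u @ v)"
| pres_rel: "(l, r) \<in> R \<Longrightarrow> pres_eq R (u @ l @ v) (u @ r @ v)"

definition pres_class :: "('a gword \<times> 'a gword) set \<Rightarrow> 'a gword \<Rightarrow> 'a gword set" where
  "pres_class R w = {v. pres_eq R w v}"

definition presented_group :: "('a gword \<times> 'a gword) set \<Rightarrow> 'a gword set monoid" where
  "presented_group R =
    \<lparr>carrier = range (pres_class R),
     mult = (\<lambda>A B. \<Union>u\<in>A. \<Union>v\<in>B. pres_class R (u @ v)),
     one = pres_class R []\<rparr>"

lemma pres_class_eq_iff: "pres_class R u = pres_class R v \<longleftrightarrow> pres_eq R u v"
  unfolding pres_class_def by (auto intro: pres_refl pres_sym pres_trans)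

lemma pres_eq_context: "pres_eq R u v \<Longrightarrow> pres_eq R (a @ u @ b) (a @ v @ b)"
proof (induction rule: pres_eq.induct)
  case (pres_cancel u x c v)
  show ?case using pres_eq.pres_cancel[of R "a @ u" x c "v @ b"] by simp
next
  case (pres_rel l r u v)
  then show ?case using pres_eq.pres_rel[of l r R "a @ u" "v @ b"] by simp
qed (auto intro: pres_eq.pres_refl pres_eq.pres_sym pres_eq.pres_trans)

lemma pres_eq_append: "pres_eq R u u' \<Longrightarrow> pres_eq R v v' \<Longrightarrow> pres_eq R (u @ v) (u' @ v')"
  using pres_eq_context[of R u u' "[]" v] pres_eq_context[of R v v' u' "[]"]
  by (auto intro: pres_trans)

lemma presented_group_mult:
  "pres_class R u \<otimes>\<^bsub>presented_group R\<^esub> pres_class R v = pres_class R (u @ v)"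
proof -
  have "w \<in> pres_class R (u @ v)"
    if "u' \<in> pres_class R u" "v' \<in> pres_class R v" "w \<in> pres_class R (u' @ v')" for u' v' w
    using that pres_eq_append[of R u u' v v'] pres_trans[of R "u @ v" "u' @ v'" w]
    by (simp add: pres_class_def)
  moreover have "u \<in> pres_class R u" "v \<in> pres_class R v"
    by (simp_all add: pres_class_def pres_refl)
  ultimately have "(\<Union>u'\<in>pres_class R u. \<Union>v'\<in>pres_class R v. pres_class R (u' @ v'))
      = pres_class R (u @ v)"
    by blast
  then show ?thesis by (simp add: presented_group_def)
qed

lemma presented_group_one: "\<one>\<^bsub>presented_group R\<^esub> = pres_class R []"
  and presented_group_carrier: "carrier (presented_group R) = range (pres_class R)"
  by (simp_all add: presented_group_def)

definition inv_gword :: "'a gword \<Rightarrow> 'a gword" where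
  "inv_gword w = rev (map (\<lambda>(x, b). (x, \<not> b)) w)"

lemma pres_eq_inv_gword: "pres_eq R (inv_gword w @ w) []"
proof (induction w)
  case Nil
  then show ?case by (simp add: inv_gword_def pres_refl)
next
  case (Cons a w)
  obtain x b where a: "a = (x, b)" by force
  have "pres_eq R (inv_gword w @ [(x, \<not> b), (x, \<not> \<not> b)] @ w) (inv_gword w @ w)"
    by (rule pres_cancel)
  with Cons show ?case by (auto simp: a inv_gword_def intro: pres_trans)
qed

lemma group_presented_group: "group (presented_group R)"
proof (rule groupI)
  fix x assume "x \<in> carrier (presented_group R)"
  then obtain w where "x = pres_class R w" by (auto simp: presented_group_carrier)
  then show "\<exists>y\<in>carrier (presented_group R). y \<otimes>\<^bsub>presented_group R\<^esub> x = \<one>\<^bsub>presented_group R\<^esub>"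
    by (intro bexI[of _ "pres_class R (inv_gword w)"])
      (auto simp: presented_group_carrier presented_group_mult presented_group_one
        pres_class_eq_iff pres_eq_inv_gword)
qed (auto simp: presented_group_carrier presented_group_mult presented_group_one)

section \<open>The dihedral group of order \<open>2n\<close>\<close>

datatype dihedral_gen = Tau | Sigma

definition dihedral_relations :: "nat \<Rightarrow> (dihedral_gen gword \<times> dihedral_gen gword) set" where
  "dihedral_relations n =
    {(replicate n (Tau, True), []),
     (replicate 2 (Sigma, True), []),
     ([(Sigma, True), (Tau, True), (Sigma, True)], [(Tau, False)])}"

definition dihedral_group :: "nat \<Rightarrow> dihedral_gen gword set monoid" where
  "dihedral_group n = presented_group (dihedral_relations n)"

section \<open>Cayley graphs\<close>

text \<open>
  As usual in \<open>Graph_Theory\<close>, an undirected graph is a symmetric digraph: an edge between \<open>g\<close> and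
  \<open>h\<close> is represented by the two arcs \<open>(g, h)\<close> and \<open>(h, g)\<close>.
\<close>

definition cayley_graph :: "('a, 'm) monoid_scheme \<Rightarrow> 'a set \<Rightarrow> 'a pair_pre_digraph" where
  "cayley_graph G S =
    \<lparr>pverts = carrier G,
     parcs = {(g, h). g \<in> carrier G \<and> h \<in> carrier G \<and> h \<otimes>\<^bsub>G\<^esub> inv\<^bsub>G\<^esub> g \<in> S}\<rparr>"

definition connection_sets :: "('a, 'm) monoid_scheme \<Rightarrow> 'a set set" where
  "connection_sets G = {S. S \<subseteq> carrier G - {\<one>\<^bsub>G\<^esub>} \<and> m_inv G ` S = S}"

lemma (in group) pair_graph_cayley_graph:
  assumes "finite (carrier G)" "S \<in> connection_sets G"
  shows "pair_graph (cayley_graph G S)"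
proof unfold_locales
  let ?C = "cayley_graph G S"
  show "finite (pverts ?C)" using assms by (simp add: cayley_graph_def)
  have "parcs ?C \<subseteq> carrier G \<times> carrier G" by (auto simp: cayley_graph_def)
  then show "finite (parcs ?C)" by (rule finite_subset) (simp add: assms(1))
  show "fst e \<noteq> snd e" if "e \<in> parcs ?C" for e
    using that assms(2) by (auto simp: cayley_graph_def connection_sets_def)
  have "g \<otimes> inv h \<in> S" if "g \<in> carrier G" "h \<in> carrier G" "h \<otimes> inv g \<in> S" for g h
  proof -
    have "inv (h \<otimes> inv g) \<in> m_inv G ` S" using that by blast
    then show ?thesis using that assms(2) by (simp add: inv_mult_group connection_sets_def)
  qed
  then show "symmetric (with_proj ?C)"
    by (auto simp: symmetric_def sym_def cayley_graph_def)
qed (auto simp: cayley_graph_def)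

definition cayley_graphs :: "('a, 'm) monoid_scheme \<Rightarrow> 'a pair_pre_digraph set" where
  "cayley_graphs G = cayley_graph G ` connection_sets G"

definition cayley_iso :: "('a, 'm) monoid_scheme \<Rightarrow> 'a pair_pre_digraph rel" where
  "cayley_iso G =
    {(X, Y) \<in> cayley_graphs G \<times> cayley_graphs G. digraph_iso (with_proj X) (with_proj Y)}"

lemma digraph_iso_with_proj_iff:
  assumes "pair_wf_digraph X" "pair_wf_digraph Y"
  shows "digraph_iso (with_proj X) (with_proj Y) \<longleftrightarrow>
    (\<exists>f. bij_betw f (pverts X) (pverts Y) \<and>
      (\<forall>u\<in>pverts X. \<forall>v\<in>pverts X. (u, v) \<in> parcs X \<longleftrightarrow> (f u, f v) \<in> parcs Y))"
    (is "?L \<longleftrightarrow> ?R")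
proof
  interpret X: pair_wf_digraph X by fact
  assume ?L
  then obtain h where h: "pre_digraph.digraph_isomorphism (with_proj X) h"
    and Y: "with_proj Y = app_iso h (with_proj X)"
    by (auto simp: digraph_iso_def)
  have inj: "inj_on (iso_verts h) (pverts X)"
    and ta: "\<And>a. a \<in> parcs X \<Longrightarrow> iso_arcs h a = (iso_verts h (fst a), iso_verts h (snd a))"
    using h arg_cong[OF Y, of tail] arg_cong[OF Y, of head]
    by (auto simp: pre_digraph.digraph_isomorphism_def prod_eq_iff)
  have V: "pverts Y = iso_verts h ` pverts X" and A: "parcs Y = iso_arcs h ` parcs X"
    using arg_cong[OF Y, of verts] arg_cong[OF Y, of arcs] by auto
  have "(u, v) \<in> parcs X \<longleftrightarrow> (iso_verts h u, iso_verts h v) \<in> parcs Y"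
    if "u \<in> pverts X" "v \<in> pverts X" for u v
  proof
    assume "(u, v) \<in> parcs X"
    then show "(iso_verts h u, iso_verts h v) \<in> parcs Y" using ta[of "(u, v)"] A by force
  next
    assume "(iso_verts h u, iso_verts h v) \<in> parcs Y"
    then obtain a where a: "a \<in> parcs X" "iso_verts h u = iso_verts h (fst a)"
      "iso_verts h v = iso_verts h (snd a)"
      using A ta by auto
    then have "u = fst a" "v = snd a"
      using inj that X.arc_fst_in_verts X.arc_snd_in_verts by (auto dest: inj_onD)
    with a show "(u, v) \<in> parcs X" by simp
  qed
  with V inj show ?R by (intro exI[of _ "iso_verts h"]) (auto simp: bij_betw_def)
next
  interpret X: pair_wf_digraph X by fact
  interpret Y: pair_wf_digraph Y by fact
  assume ?R
  then obtain f where f: "bij_betw f (pverts X) (pverts Y)"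
    and e: "\<And>u v. u \<in> pverts X \<Longrightarrow> v \<in> pverts X \<Longrightarrow> (u, v) \<in> parcs X \<longleftrightarrow> (f u, f v) \<in> parcs Y"
    by blast
  let ?h = "\<lparr>iso_verts = f, iso_arcs = map_prod f f, iso_head = snd, iso_tail = fst\<rparr>"
  have inj: "inj_on f (pverts X)" and im: "f ` pverts X = pverts Y"
    using f by (auto simp: bij_betw_def)
  have "inj_on (map_prod f f) (parcs X)"
  proof (rule inj_onI)
    fix a b assume ab: "a \<in> parcs X" "b \<in> parcs X" "map_prod f f a = map_prod f f b"
    then have "f (fst a) = f (fst b)" "f (snd a) = f (snd b)"
      by (auto simp: prod_eq_iff)
    then show "a = b"
      using inj_onD[OF inj, of "fst a" "fst b"] inj_onD[OF inj, of "snd a" "snd b"] ab(1,2)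
      by (simp add: prod_eq_iff X.arc_fst_in_verts X.arc_snd_in_verts)
  qed
  then have "pre_digraph.digraph_isomorphism (with_proj X) ?h"
    using inj X.wf_digraph by (auto simp: pre_digraph.digraph_isomorphism_def)
  moreover have "parcs Y = map_prod f f ` parcs X"
  proof (intro equalityI subsetI)
    fix a assume a: "a \<in> parcs Y"
    then obtain u v where "u \<in> pverts X" "v \<in> pverts X" "a = (f u, f v)"
      using im Y.arc_fst_in_verts[OF a] Y.arc_snd_in_verts[OF a] by (metis imageE prod.collapse)
    with a e show "a \<in> map_prod f f ` parcs X" by force
  next
    fix a assume "a \<in> map_prod f f ` parcs X"
    then show "a \<in> parcs Y" using e by (auto dest: X.wellformed')
  qed
  ultimately show ?L
    using im by (intro digraph_iso_def[THEN meta_eq_to_obj_eq, THEN iffD2] exI[of _ ?h])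
      (auto simp: app_iso_def with_proj_def)
qed

lemma pair_wf_digraph_cayley_graphs: "X \<in> cayley_graphs G \<Longrightarrow> pair_wf_digraph X"
  by (auto simp: cayley_graphs_def cayley_graph_def pair_wf_digraph_def)

lemma equiv_cayley_iso: "equiv (cayley_graphs G) (cayley_iso G)"
proof (rule equivI)
  note iff = digraph_iso_with_proj_iff[OF pair_wf_digraph_cayley_graphs pair_wf_digraph_cayley_graphs]
  show "cayley_iso G \<subseteq> cayley_graphs G \<times> cayley_graphs G" by (auto simp: cayley_iso_def)
  show "refl_on (cayley_graphs G) (cayley_iso G)"
    by (auto simp: refl_on_def cayley_iso_def iff intro!: exI[of _ id])
  show "sym (cayley_iso G)"
  proof (rule symI)
    fix X Y assume XY: "(X, Y) \<in> cayley_iso G"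
    then obtain f where f: "bij_betw f (pverts X) (pverts Y)"
      and e: "\<forall>u\<in>pverts X. \<forall>v\<in>pverts X. (u, v) \<in> parcs X \<longleftrightarrow> (f u, f v) \<in> parcs Y"
      by (auto simp: cayley_iso_def iff)
    have "bij_betw (inv_into (pverts X) f) (pverts Y) (pverts X)"
      using f by (rule bij_betw_inv_into)
    moreover have "\<forall>u\<in>pverts Y. \<forall>v\<in>pverts Y. (u, v) \<in> parcs Y \<longleftrightarrow>
        (inv_into (pverts X) f u, inv_into (pverts X) f v) \<in> parcs X"
      using f e by (metis bij_betw_def f_inv_into_f inv_into_into)
    ultimately show "(Y, X) \<in> cayley_iso G"
      using XY by (auto simp: cayley_iso_def iff)
  qed
  show "trans (cayley_iso G)"
  proof (rule transI)
    fix X Y Z assume XY: "(X, Y) \<in> cayley_iso G" and YZ: "(Y, Z) \<in> cayley_iso G"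
    obtain f where f: "bij_betw f (pverts X) (pverts Y)"
      and e: "\<forall>u\<in>pverts X. \<forall>v\<in>pverts X. (u, v) \<in> parcs X \<longleftrightarrow> (f u, f v) \<in> parcs Y"
      using XY by (auto simp: cayley_iso_def iff)
    obtain g where g: "bij_betw g (pverts Y) (pverts Z)"
      and e': "\<forall>u\<in>pverts Y. \<forall>v\<in>pverts Y. (u, v) \<in> parcs Y \<longleftrightarrow> (g u, g v) \<in> parcs Z"
      using YZ by (auto simp: cayley_iso_def iff)
    have "bij_betw (g \<circ> f) (pverts X) (pverts Z)" using f g by (rule bij_betw_trans)
    moreover have "\<forall>u\<in>pverts X. \<forall>v\<in>pverts X. (u, v) \<in> parcs X \<longleftrightarrow>
        ((g \<circ> f) u, (g \<circ> f) v) \<in> parcs Z"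
      using e e' bij_betwE[OF f] by simp
    moreover have XZ: "X \<in> cayley_graphs G" "Z \<in> cayley_graphs G"
      using XY YZ by (auto simp: cayley_iso_def)
    ultimately have "digraph_iso (with_proj X) (with_proj Z)"
      unfolding iff[OF XZ] by blast
    with XZ show "(X, Z) \<in> cayley_iso G" by (simp add: cayley_iso_def)
  qed
qed

end

theory Submission
  imports Defs "HOL-Number_Theory.Residue_Primitive_Roots" "HOL-Combinatorics.Permutations"
    "HOL-Algebra.Group_Action"
begin

text \<open>
  In the coordinates \<open>\<tau>\<^sup>x\<sigma>\<^sup>b\<close> a Cayley graph on the dihedral group is given by a symmetric set \<open>R\<close> of
  nonzero residues modulo \<open>p\<close> (the rotations) and an arbitrary set \<open>T\<close> of residues (the reflections),
  and automorphisms of the group act on \<open>(R, T)\<close> by \<open>x \<mapsto> a x\<close> and \<open>x \<mapsto> a x + b\<close>. Isomorphic Cayley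
  graphs are related by such an affine map. If \<open>T\<close> is neither empty nor full, an automorphism of order
  \<open>p\<close> commuting with the rotation \<open>\<rho>\<close> is a power of \<open>\<rho>\<close>; a Sylow-type counting argument then corrects
  any isomorphism to one that normalizes \<open>\<rho>\<close>, and such a map is affine. If \<open>T\<close> is empty, a parity
  argument shows that it is so for the other graph, and the same counting argument applies to the
  circulant graph of \<open>R\<close>; the case of a full \<open>T\<close> follows by complementation. Burnside's lemma for the
  affine group gives the number of classes: through a primitive root, the sets invariant under a
  multiplication become shift-invariant sets of exponents, and these are counted by powers of two with
  a gcd as exponent.
\<close>

section \<open>Conjugacy of elements of prime order\<close>

text \<open>The obstacle behind the case distinction on \<open>T\<close> is the centralizer of
  \<open>\<rho>\<close>, which is right multiplication by tau. For empty or full \<open>T\<close>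
  each half can be rotated on its own, so this centralizer contains automorphisms of order
  \<open>p\<close> that are not powers of \<open>\<rho>\<close>, and the counting argument breaks
  down on the whole vertex set; on a single half the rotation is self-centralizing again. The shape
  of the formula comes from the translations. For \<open>a \<noteq> 1\<close> all \<open>p\<close>
  maps \<open>x \<mapsto> a x + b\<close> have a fixed residue and count like
  \<open>x \<mapsto> a x\<close>. The index \<open>i\<close> of the sum is the exponent of
  \<open>a\<close>, with \<open>i = 0\<close> for \<open>a = 1\<close>, and the factor 2 is the free
  choice whether 0 lies in \<open>T\<close>. For \<open>a = 1\<close>, however, each of the
  \<open>p - 1\<close> nonzero translations leaves only 2 sets \<open>T\<close> invariant instead of
  \<open>2^p\<close>. Replacing \<open>2^p\<close> by 2 there, times the \<open>2^((p-1)/2)\<close>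
  symmetric sets \<open>R\<close>, and dividing by the group order \<open>p (p - 1)\<close> gives
  the first summand with its factor \<open>1/p\<close>.\<close>

lemma card_cong_card_fixed_points:
  fixes f :: "'a \<Rightarrow> 'a"
  assumes "prime p" "finite X" and maps: "\<And>x. x \<in> X \<Longrightarrow> f x \<in> X"
    and period: "\<And>x. x \<in> X \<Longrightarrow> (f ^^ p) x = x"
  shows "[card X = card {x \<in> X. f x = x}] (mod p)"
proof -
  have p: "p > 0" using assms(1) by (simp add: prime_gt_0_nat)
  \<comment> \<open>These are the orbits of the cyclic group of order \<open>p\<close> that acts
    through the iterates; as \<open>p\<close> is prime, an orbit is a single point or has exactly
    \<open>p\<close> elements, and \<open>N\<close> collects the points of the latter kind.\<close>
  define orb where "orb x = (\<lambda>i. (f ^^ i) x) ` {..<p}" for x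
  define N where "N = {x \<in> X. f x \<noteq> x}"
  have iter_X: "(f ^^ i) x \<in> X" if "x \<in> X" for x i
    using that maps by (induction i) auto
  have iter_mod: "(f ^^ i) x = (f ^^ (i mod p)) x" if "x \<in> X" for x i
    using period that by (simp add: funpow_mod_eq)
  have fixed_iter: "f y = y" if "x \<in> X" "y = (f ^^ i) x" "f x = x" for x y i
  proof -
    have "(f ^^ i) x = x" using that(3) by (induction i) auto
    with that show ?thesis by simp
  qed
  have iter_back: "\<exists>j. x = (f ^^ j) y" if "x \<in> X" "y = (f ^^ i) x" for x y i
  proof -
    \<comment> \<open>An iterate is undone by going forward until \<open>i\<close> full periods are
      complete.\<close>
    have "(f ^^ (p * i - i)) y = (f ^^ ((p * i - i) + i)) x"
      using that by (simp add: funpow_add)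
    also have "(p * i - i) + i = p * i" using p by (cases p) auto
    also have "(f ^^ (p * i)) x = x" using iter_mod[OF that(1), of "p * i"] by simp
    finally show ?thesis by metis
  qed
  have orb_iff: "y \<in> orb x \<longleftrightarrow> (\<exists>i. y = (f ^^ i) x)" if "x \<in> X" for x y
  proof
    assume "\<exists>i. y = (f ^^ i) x"
    then obtain i where "y = (f ^^ (i mod p)) x" using iter_mod[OF \<open>x \<in> X\<close>] by auto
    then show "y \<in> orb x" using p by (auto simp: orb_def)
  qed (auto simp: orb_def)
  have orb_N: "orb x \<subseteq> N" if "x \<in> N" for x
  proof
    fix y assume "y \<in> orb x"
    then obtain i where i: "y = (f ^^ i) x" using orb_iff \<open>x \<in> N\<close> N_def by auto
    have y: "y \<in> X" using i iter_X that N_def by auto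
    obtain j where "x = (f ^^ j) y" using iter_back[OF _ i] \<open>x \<in> N\<close> N_def by blast
    with fixed_iter[OF y this] that show "y \<in> N" by (auto simp: N_def y)
  qed
  have orb_eq: "orb x = orb y" if "x \<in> X" "y \<in> orb x" for x y
  proof -
    obtain i where i: "y = (f ^^ i) x" using \<open>x \<in> X\<close> \<open>y \<in> orb x\<close> orb_iff by auto
    obtain j where j: "x = (f ^^ j) y" using iter_back[OF _ i] \<open>x \<in> X\<close> by blast
    have y: "y \<in> X" using i iter_X that by auto
    show ?thesis
    proof (intro Set.set_eqI iffI)
      fix z assume "z \<in> orb x"
      then obtain k where "z = (f ^^ k) x" using orb_iff \<open>x \<in> X\<close> by auto
      then have "z = (f ^^ (k + j)) y" using j by (simp add: funpow_add)
      then show "z \<in> orb y" using orb_iff[OF y] by blast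
    next
      fix z assume "z \<in> orb y"
      then obtain k where "z = (f ^^ k) y" using orb_iff y by auto
      then have "z = (f ^^ (k + i)) x" using i by (simp add: funpow_add)
      then show "z \<in> orb x" using orb_iff[OF that(1)] by blast
    qed
  qed
  have card_orb: "card (orb x) = p" if "x \<in> N" for x
  proof -
    have x: "x \<in> X" "f x \<noteq> x" using that by (auto simp: N_def)
    have "inj_on (\<lambda>i. (f ^^ i) x) {..<p}"
    proof (rule linorder_inj_onI')
      fix i j assume ij: "i \<in> {..<p}" "j \<in> {..<p}" "i < j"
      show "(f ^^ i) x \<noteq> (f ^^ j) x"
      proof
        assume eq: "(f ^^ i) x = (f ^^ j) x"
        \<comment> \<open>A coincidence makes \<open>d < p\<close> a period of \<open>x\<close>;
          since \<open>d\<close> is invertible modulo \<open>p\<close>, some multiple of it is 1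
          modulo \<open>p\<close>, which would make \<open>x\<close> fixed.\<close>
        define d where "d = j - i"
        have "(f ^^ d) x = (f ^^ (d + p)) x"
          using x(1) period by (simp add: funpow_add)
        also have "d + p = (p - i) + j" using ij by (simp add: d_def)
        also have "(f ^^ ((p - i) + j)) x = (f ^^ ((p - i) + i)) x"
          using eq by (simp add: funpow_add)
        also have "\<dots> = x" using ij x(1) period by simp
        finally have d: "(f ^^ d) x = x" .
        have "0 < d" "d < p" using ij by (auto simp: d_def)
        then have "\<not> p dvd d" by (simp add: nat_dvd_not_less)
        then have "coprime d p" using prime_imp_coprime[OF assms(1)] by (simp add: coprime_commute)
        then obtain u where "[d * u = Suc 0] (mod p)" using cong_solve_coprime_nat[of d p] by auto
        then have "(f ^^ (d * u)) x = f x"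
          using iter_mod[OF x(1), of "d * u"] iter_mod[OF x(1), of 1] by (simp add: cong_def)
        moreover have "(f ^^ (d * u)) x = x"
          using d by (induction u) (simp_all add: funpow_add)
        ultimately show False using x(2) by simp
      qed
    qed
    then show ?thesis by (simp add: orb_def card_image)
  qed
  have Un: "\<Union> (orb ` N) = N"
  proof -
    have "x \<in> orb x" if "x \<in> N" for x
      using orb_iff[of x x] that by (auto simp: N_def intro: exI[of _ 0])
    then show ?thesis using orb_N by blast
  qed
  have "p dvd card N"
  proof (rule dvd_partition[of "orb ` N" p, unfolded Un])
    show "finite N" using assms(2) by (simp add: N_def)
    show "\<forall>c\<in>orb ` N. p dvd card c" using card_orb by auto
    show "\<forall>c1\<in>orb ` N. \<forall>c2\<in>orb ` N. c1 \<noteq> c2 \<longrightarrow> c1 \<inter> c2 = {}"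
    proof (intro ballI impI)
      fix c1 c2 assume "c1 \<in> orb ` N" "c2 \<in> orb ` N" "c1 \<noteq> c2"
      then obtain x y where "x \<in> X" "y \<in> X" "c1 = orb x" "c2 = orb y" by (auto simp: N_def)
      then show "c1 \<inter> c2 = {}" using orb_eq \<open>c1 \<noteq> c2\<close> by blast
    qed
  qed
  moreover have "card X = card {x \<in> X. f x = x} + card N"
    using assms(2) by (subst card_Un_disjoint[symmetric]) (auto simp: N_def intro: arg_cong[of _ _ card])
  ultimately show ?thesis by (simp add: cong_def mod_add_right_eq[symmetric])
qed

text \<open>
  This replaces Sylow's theorem: only conjugates of \<open>\<rho>\<close> that are powers of \<open>\<rho>\<close> are fixed under
  conjugation by \<open>\<rho>\<close>, so the number of conjugates is nonzero modulo \<open>p\<close>, and conjugation by \<open>\<rho>'\<close>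
  fixes one of them.
\<close>
lemma conjugate_to_power_of_self_centralizing:
  fixes A :: "('a \<Rightarrow> 'a) set" and \<rho> \<rho>' :: "'a \<Rightarrow> 'a"
  assumes "prime p" "finite A"
    and bij: "\<And>a. a \<in> A \<Longrightarrow> bij a"
    and comp: "\<And>a b. a \<in> A \<Longrightarrow> b \<in> A \<Longrightarrow> a \<circ> b \<in> A"
    and inv: "\<And>a. a \<in> A \<Longrightarrow> Hilbert_Choice.inv a \<in> A"
    and \<rho>: "\<rho> \<in> A" "\<rho> ^^ p = id" "\<rho> \<noteq> id"
    and \<rho>': "\<rho>' \<in> A" "\<rho>' ^^ p = id"
    and cent: "\<And>x. x \<in> A \<Longrightarrow> x \<circ> \<rho> = \<rho> \<circ> x \<Longrightarrow> x ^^ p = id \<Longrightarrow> \<exists>k. x = \<rho> ^^ k"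
  shows "\<exists>a\<in>A. \<exists>k. \<rho>' \<circ> a = a \<circ> \<rho> ^^ k"
proof -
  have p: "p > 0" using assms(1) by (simp add: prime_gt_0_nat)
  define conj where "conj a x = a \<circ> x \<circ> Hilbert_Choice.inv a" for a x :: "'a \<Rightarrow> 'a"
  have inv_left: "Hilbert_Choice.inv a \<circ> a = id" and inv_right: "a \<circ> Hilbert_Choice.inv a = id"
    if "a \<in> A" for a
    using bij[OF that] by (simp_all add: bij_is_inj surj_iff[symmetric] bij_is_surj)
  have conj_eq_iff: "conj a x = y \<longleftrightarrow> a \<circ> x = y \<circ> a" if "a \<in> A" for a x y
  proof
    assume "conj a x = y"
    then have "y \<circ> a = a \<circ> x \<circ> (Hilbert_Choice.inv a \<circ> a)" by (auto simp: conj_def comp_assoc)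
    then show "a \<circ> x = y \<circ> a" using inv_left[OF that] by simp
  next
    assume "a \<circ> x = y \<circ> a"
    then have "conj a x = y \<circ> (a \<circ> Hilbert_Choice.inv a)" by (simp add: conj_def comp_assoc)
    then show "conj a x = y" using inv_right[OF that] by simp
  qed
  have conj_conj: "conj a (conj b x) = conj (a \<circ> b) x" if "a \<in> A" "b \<in> A" for a b x
    using bij that by (simp add: conj_def o_inv_distrib comp_assoc)
  have conj_pow: "(conj a ^^ n) x = conj (a ^^ n) x" if "a \<in> A" for a n x
  proof (induction n)
    case (Suc n)
    have "bij (a ^^ n)" using bij that by (simp add: bij_fn)
    then have "Hilbert_Choice.inv (a \<circ> a ^^ n) = Hilbert_Choice.inv (a ^^ n) \<circ> Hilbert_Choice.inv a"
      using bij that by (simp add: o_inv_distrib)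
    then have "conj a (conj (a ^^ n) x) = conj (a \<circ> a ^^ n) x"
      by (simp only: conj_def comp_assoc)
    then show ?case using Suc by (metis comp_apply funpow.simps(2))
  qed (simp add: conj_def)
  have pow_conj: "conj a x ^^ n = conj a (x ^^ n)" if "a \<in> A" for a n x
  proof (induction n)
    case 0
    then show ?case by (simp only: funpow.simps conj_def comp_id inv_right[OF that])
  next
    case (Suc n)
    have "conj a x \<circ> conj a (x ^^ n) = a \<circ> x \<circ> (Hilbert_Choice.inv a \<circ> a) \<circ> x ^^ n \<circ> Hilbert_Choice.inv a"
      by (simp add: conj_def comp_assoc)
    then show ?case using Suc by (simp only: funpow.simps conj_def comp_id inv_left[OF that] comp_assoc)
  qed
  define Y where "Y = (\<lambda>a. conj a \<rho>) ` A"
  have fixed_count: "[card Y = card {y \<in> Y. conj r y = y}] (mod p)" if "r \<in> A" "r ^^ p = id" for r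
  proof (rule card_cong_card_fixed_points[OF assms(1)])
    show "finite Y" using assms(2) by (simp add: Y_def)
    show "conj r y \<in> Y" if "y \<in> Y" for y
      using that comp \<open>r \<in> A\<close> by (auto simp: Y_def conj_conj)
    show "(conj r ^^ p) y = y" for y using conj_pow that by (simp add: conj_def)
  qed
  \<comment> \<open>A fixed conjugate commutes with \<open>\<rho>\<close>, hence is a power of it by
    \<open>cent\<close>, and the exponent 0 is excluded because a conjugate of \<open>\<rho>\<close>
    is not the identity. As \<open>\<rho>\<close> is itself fixed, the count lies between 1 and
    \<open>p - 1\<close>.\<close>
  have "{y \<in> Y. conj \<rho> y = y} \<subseteq> (\<lambda>k. \<rho> ^^ k) ` {1..<p}"
  proof
    fix y assume y: "y \<in> {y \<in> Y. conj \<rho> y = y}"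
    then obtain a where a: "a \<in> A" "y = conj a \<rho>" by (auto simp: Y_def)
    have "y ^^ p = id" using a \<rho> pow_conj inv_right by (simp add: conj_def)
    moreover have "y \<in> A" using a comp inv \<rho> by (simp add: conj_def)
    moreover have "y \<circ> \<rho> = \<rho> \<circ> y" using y conj_eq_iff \<rho>(1) by auto
    ultimately obtain k where "y = \<rho> ^^ k" using cent by blast
    also have "\<dots> = \<rho> ^^ (k mod p)"
      using \<rho>(2) by (intro ext) (simp add: funpow_mod_eq)
    finally have k: "y = \<rho> ^^ (k mod p)" .
    have "y \<noteq> id"
    proof
      assume "y = id"
      then have "a \<circ> \<rho> = a" using a conj_eq_iff[of a \<rho> id] by simp
      then have "Hilbert_Choice.inv a \<circ> a \<circ> \<rho> = Hilbert_Choice.inv a \<circ> a" by (simp add: comp_assoc)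
      then show False using inv_left a \<rho> by simp
    qed
    then have "k mod p \<noteq> 0" using k by (cases "k mod p") auto
    then show "y \<in> (\<lambda>k. \<rho> ^^ k) ` {1..<p}" using k p by auto
  qed
  then have "card {y \<in> Y. conj \<rho> y = y} \<le> card ((\<lambda>k. \<rho> ^^ k) ` {1..<p})"
    by (intro card_mono) auto
  also have "\<dots> \<le> p - 1" using card_image_le[of "{1..<p}"] by simp
  finally have "card {y \<in> Y. conj \<rho> y = y} < p" using p by linarith
  moreover have "card {y \<in> Y. conj \<rho> y = y} \<noteq> 0"
  proof -
    have "conj \<rho> \<rho> = \<rho>" using conj_eq_iff \<rho>(1) by auto
    then have "\<rho> \<in> {y \<in> Y. conj \<rho> y = y}" using \<rho>(1) by (force simp: Y_def)
    moreover have "finite Y" using assms(2) by (simp add: Y_def)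
    ultimately show ?thesis by auto
  qed
  ultimately have "\<not> [card Y = 0] (mod p)"
    using fixed_count[OF \<rho>(1,2)] by (simp add: cong_def)
  then have "card {y \<in> Y. conj \<rho>' y = y} \<noteq> 0"
    using fixed_count[OF \<rho>'] by (intro notI) (simp only:)
  then have "{y \<in> Y. conj \<rho>' y = y} \<noteq> {}" by force
  then obtain a where a: "a \<in> A" "conj \<rho>' (conj a \<rho>) = conj a \<rho>"
    by (auto simp: Y_def)
  \<comment> \<open>Now \<open>\<rho>'\<close> commutes with the conjugate of \<open>\<rho>\<close>
    by \<open>a\<close>; carried back along \<open>a\<close>, the map
    \<open>b \<circ> \<rho>' \<circ> a\<close> commutes with \<open>\<rho>\<close> itself, so
    \<open>cent\<close> applies to it.\<close>
  define b where "b = Hilbert_Choice.inv a"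
  have b: "b \<in> A" using a inv by (simp add: b_def)
  have ab: "a \<circ> b = id" "b \<circ> a = id" using inv_left inv_right a by (auto simp: b_def)
  have invb: "Hilbert_Choice.inv b = a" using a bij by (simp add: b_def inv_inv_eq)
  have "\<rho>' \<circ> (a \<circ> \<rho> \<circ> b) = (a \<circ> \<rho> \<circ> b) \<circ> \<rho>'"
    using a(2) conj_eq_iff[OF \<rho>'(1)] by (simp add: conj_def b_def)
  then have "b \<circ> (\<rho>' \<circ> (a \<circ> \<rho> \<circ> b)) \<circ> a = b \<circ> ((a \<circ> \<rho> \<circ> b) \<circ> \<rho>') \<circ> a" by simp
  then have "b \<circ> \<rho>' \<circ> a \<circ> \<rho> \<circ> (b \<circ> a) = (b \<circ> a) \<circ> \<rho> \<circ> b \<circ> \<rho>' \<circ> a"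
    by (simp only: comp_assoc)
  then have "(b \<circ> \<rho>' \<circ> a) \<circ> \<rho> = \<rho> \<circ> (b \<circ> \<rho>' \<circ> a)" using ab by (simp add: comp_assoc)
  moreover have "(b \<circ> \<rho>' \<circ> a) ^^ p = id"
    using pow_conj[OF b, of p \<rho>'] \<rho>'(2) ab by (simp add: conj_def invb)
  ultimately obtain k where "b \<circ> \<rho>' \<circ> a = \<rho> ^^ k"
    using cent[of "b \<circ> \<rho>' \<circ> a"] a b \<rho>' comp by blast
  then have "a \<circ> (b \<circ> \<rho>' \<circ> a) = a \<circ> \<rho> ^^ k" by simp
  then have "(a \<circ> b) \<circ> \<rho>' \<circ> a = a \<circ> \<rho> ^^ k" by (simp only: comp_assoc)
  then show ?thesis using ab a by auto
qed

lemma funpow_comp_commute: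
  assumes "x \<circ> r = r \<circ> x"
  shows "x ((r ^^ m) v) = (r ^^ m) (x v)"
  using fun_cong[OF assms] by (induction m) auto

text \<open>Pulling \<open>\<rho>\<close> back along \<open>\<phi>\<close> gives a second
  automorphism \<open>\<rho>'\<close> of the first graph with period \<open>p\<close>. Correcting
  \<open>\<phi>\<close> by the automorphism that conjugates \<open>\<rho>'\<close> into the powers
  of \<open>\<rho>\<close> yields \<open>\<psi>\<close>. What remains to be shown for a particular
  graph is \<open>cent\<close>.\<close>

lemma isomorphism_normalizing_rotation:
  fixes V :: "'a set" and \<rho> \<phi> :: "'a \<Rightarrow> 'a"
  assumes p: "prime p" and V: "finite V"
    and \<rho>: "\<rho> permutes V" "\<rho> ^^ p = id" "\<rho> \<noteq> id"
    and E: "\<And>u v. u \<in> V \<Longrightarrow> v \<in> V \<Longrightarrow> E (\<rho> u) (\<rho> v) \<longleftrightarrow> E u v"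
    and E': "\<And>u v. u \<in> V \<Longrightarrow> v \<in> V \<Longrightarrow> E' (\<rho> u) (\<rho> v) \<longleftrightarrow> E' u v"
    and \<phi>: "bij_betw \<phi> V V" "\<And>u v. u \<in> V \<Longrightarrow> v \<in> V \<Longrightarrow> E u v \<longleftrightarrow> E' (\<phi> u) (\<phi> v)"
    and cent: "\<And>x. x permutes V \<Longrightarrow> (\<And>u v. u \<in> V \<Longrightarrow> v \<in> V \<Longrightarrow> E (x u) (x v) \<longleftrightarrow> E u v)
      \<Longrightarrow> x \<circ> \<rho> = \<rho> \<circ> x \<Longrightarrow> x ^^ p = id \<Longrightarrow> \<exists>k. x = \<rho> ^^ k"
  obtains \<psi> c where "\<psi> permutes V" "\<And>u v. u \<in> V \<Longrightarrow> v \<in> V \<Longrightarrow> E u v \<longleftrightarrow> E' (\<psi> u) (\<psi> v)"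
    "0 < c" "c < p" "\<And>m v. \<psi> ((\<rho> ^^ m) v) = (\<rho> ^^ (c * m)) (\<psi> v)"
proof -
  define A where "A = {x. x permutes V \<and> (\<forall>u\<in>V. \<forall>v\<in>V. E (x u) (x v) \<longleftrightarrow> E u v)}"
  \<comment> \<open>\<open>\<phi>\<close> is arbitrary outside \<open>V\<close>; extending by the
    identity makes it a permutation of the whole type, so that global inverses and compositions are
    available.\<close>
  define f where "f v = (if v \<in> V then \<phi> v else v)" for v
  have f: "f permutes V"
  proof (rule bij_imp_permutes)
    show "bij_betw f V V" using \<phi>(1) by (rule bij_betw_cong[THEN iffD1, rotated]) (simp add: f_def)
  qed (simp add: f_def)
  have fE: "E u v \<longleftrightarrow> E' (f u) (f v)" if "u \<in> V" "v \<in> V" for u v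
    using that \<phi>(2) by (simp add: f_def)
  define g where "g = Hilbert_Choice.inv f"
  have g: "g permutes V" using f by (simp add: g_def permutes_inv)
  have fg: "f (g v) = v" and gf: "g (f v) = v" for v
    using f by (simp_all add: g_def permutes_inverses)
  define \<rho>' where "\<rho>' = g \<circ> \<rho> \<circ> f"
  have pow': "\<rho>' ^^ n = g \<circ> \<rho> ^^ n \<circ> f" for n
    by (induction n) (auto simp: \<rho>'_def fun_eq_iff fg gf)
  have gE: "E (g u) (g v) \<longleftrightarrow> E' u v" if "u \<in> V" "v \<in> V" for u v
    using fE[of "g u" "g v"] that g by (simp add: fg permutes_in_image)
  have "\<exists>a\<in>A. \<exists>k. \<rho>' \<circ> a = a \<circ> \<rho> ^^ k"
  proof (rule conjugate_to_power_of_self_centralizing[OF p])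
    show "finite A" by (rule finite_subset[OF _ finite_permutations[OF V]]) (auto simp: A_def)
    show "bij a" if "a \<in> A" for a using that by (auto simp: A_def permutes_bij)
    show "a \<circ> b \<in> A" if "a \<in> A" "b \<in> A" for a b
      using that by (auto simp: A_def permutes_compose permutes_in_image)
    show "Hilbert_Choice.inv a \<in> A" if "a \<in> A" for a
    proof -
      have a: "a permutes V" using that by (simp add: A_def)
      have "E (Hilbert_Choice.inv a u) (Hilbert_Choice.inv a v) \<longleftrightarrow> E u v" if "u \<in> V" "v \<in> V" for u v
      proof -
        have "Hilbert_Choice.inv a u \<in> V" "Hilbert_Choice.inv a v \<in> V"
          using that permutes_in_image[OF permutes_inv[OF a]] by auto
        then show ?thesis using \<open>a \<in> A\<close> permutes_inverses(1)[OF a] by (force simp: A_def)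
      qed
      then show ?thesis using permutes_inv[OF a] by (simp add: A_def)
    qed
    show "\<rho> \<in> A" using \<rho> E by (simp add: A_def)
    show "\<rho> ^^ p = id" "\<rho> \<noteq> id" by fact+
    show "\<rho>' ^^ p = id" by (simp add: pow' \<rho> fun_eq_iff gf)
    show "\<rho>' \<in> A"
      using g \<rho>(1) f by (auto simp: A_def \<rho>'_def permutes_compose permutes_in_image gE E' fE fg)
    show "\<exists>k. x = \<rho> ^^ k" if "x \<in> A" "x \<circ> \<rho> = \<rho> \<circ> x" "x ^^ p = id" for x
      using that cent by (simp add: A_def)
  qed
  then obtain a k where a: "a \<in> A" "\<rho>' \<circ> a = a \<circ> \<rho> ^^ k" by blast
  define \<psi> where "\<psi> = f \<circ> a"
  have \<psi>: "\<psi> permutes V" using a f by (simp add: \<psi>_def A_def permutes_compose)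
  have \<psi>E: "E u v \<longleftrightarrow> E' (\<psi> u) (\<psi> v)" if "u \<in> V" "v \<in> V" for u v
    using that a fE[of "a u" "a v"] by (auto simp: \<psi>_def A_def permutes_in_image)
  have step: "\<rho> (\<psi> v) = \<psi> ((\<rho> ^^ k) v)" for v
  proof -
    have "f (\<rho>' (a v)) = f (a ((\<rho> ^^ k) v))" using fun_cong[OF a(2), of v] by simp
    then show ?thesis by (simp add: \<psi>_def \<rho>'_def fg)
  qed
  have steps: "(\<rho> ^^ n) (\<psi> v) = \<psi> ((\<rho> ^^ (k * n)) v)" for n v
    by (induction n arbitrary: v) (simp_all add: step funpow_add funpow_swap1)
  have \<rho>_mod: "\<rho> ^^ n = \<rho> ^^ (n mod p)" for n
    using \<rho>(2) by (intro ext) (simp add: funpow_mod_eq)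
  \<comment> \<open>Otherwise \<open>\<rho>\<close> would fix every value of the surjective
    \<open>\<psi>\<close>.\<close>
  have "\<not> p dvd k"
  proof
    assume "p dvd k"
    then have "\<rho> ^^ k = id" using \<rho>_mod[of k] by (auto simp: fun_eq_iff)
    then have "\<rho> (\<psi> v) = \<psi> v" for v using step[of v] by simp
    then have "\<rho> v = v" for v using permutes_surj[OF \<psi>] by (metis surjD)
    then show False using \<rho>(3) by auto
  qed
  then have "coprime k p" using prime_imp_coprime[OF p] by (simp add: coprime_commute)
  \<comment> \<open>By \<open>step\<close>, passing \<open>\<rho> ^^ k\<close> through
    \<open>\<psi>\<close> leaves \<open>\<rho>\<close>; the factor \<open>c\<close> of the
    conclusion is therefore the inverse of \<open>k\<close> modulo \<open>p\<close>.\<close>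
  then obtain c' where c': "[k * c' = Suc 0] (mod p)" using cong_solve_coprime_nat[of k p] by auto
  define c where "c = c' mod p"
  have c: "[k * c = Suc 0] (mod p)" using c' by (simp add: c_def cong_def mod_mult_right_eq)
  have "p > 1" using p by (rule prime_gt_1_nat)
  then have "0 < c" using c by (cases "c = 0") (auto simp: cong_def)
  moreover have "c < p" using \<open>p > 1\<close> by (simp add: c_def)
  moreover have "\<psi> ((\<rho> ^^ m) v) = (\<rho> ^^ (c * m)) (\<psi> v)" for m v
  proof -
    have "[k * c * m = Suc 0 * m] (mod p)" using c by (rule cong_scalar_right)
    then have "\<rho> ^^ (k * (c * m)) = \<rho> ^^ m"
      using \<rho>_mod[of "k * (c * m)"] \<rho>_mod[of m] by (simp add: cong_def mult.assoc)
    then show ?thesis using steps[of "c * m" v] by simp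
  qed
  ultimately show ?thesis using that \<psi> \<psi>E by blast
qed

text \<open>Modulo a prime every nonzero \<open>d\<close> generates the additive group, so any
  residue is reached from any other by repeated steps of \<open>d\<close>.\<close>

lemma shift_invariant_residues_trivial:
  fixes p d :: int
  assumes p: "prime p" and d: "\<not> p dvd d" and T: "T \<subseteq> {0..<p}"
    and shift: "\<And>x. x \<in> {0..<p} \<Longrightarrow> x \<in> T \<longleftrightarrow> (x + d) mod p \<in> T"
  shows "T = {} \<or> T = {0..<p}"
proof (rule ccontr)
  assume "\<not> ?thesis"
  then obtain x y where x: "x \<in> T" and y: "y \<in> {0..<p}" "y \<notin> T" using T by blast
  have p0: "p > 0" using p by (simp add: prime_gt_0_int)
  have iter: "(x + int n * d) mod p \<in> T" for n
  proof (induction n)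
    case 0
    then show ?case using x T by auto
  next
    case (Suc n)
    moreover have "(x + int n * d) mod p \<in> {0..<p}" using p0 by simp
    ultimately have "((x + int n * d) mod p + d) mod p \<in> T" using shift by blast
    then show ?case by (simp add: mod_simps algebra_simps)
  qed
  have "coprime d p" using prime_imp_coprime[OF p d] by (simp add: coprime_commute)
  then obtain e where "[d * e = 1] (mod p)" by (auto dest: cong_solve_coprime_int)
  then have "[(d * e) * (y - x) = 1 * (y - x)] (mod p)" by (rule cong_scalar_right)
  moreover define n where "n = nat ((e * (y - x)) mod p)"
  ultimately have "[int n * d = y - x] (mod p)"
    using p0 by (simp add: cong_def mod_simps algebra_simps)
  then have "[x + int n * d = x + (y - x)] (mod p)" by (intro cong_add) auto
  then have "(x + int n * d) mod p = y" using y by (simp add: cong_def)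
  then show False using iter[of n] y by simp
qed

section \<open>Isomorphisms of Cayley graphs on the dihedral group\<close>

text \<open>
  The pair \<open>(x, b)\<close> stands for \<open>\<tau>\<^sup>x\<sigma>\<^sup>b\<close>, and \<open>R\<close>, \<open>T\<close> collect the \<open>x\<close> for which \<open>\<tau>\<^sup>x\<close>, respectively \<open>\<tau>\<^sup>x\<sigma>\<close>,
  lies in the connection set. The adjacency condition is read off
  \<open>\<tau>\<^sup>y\<sigma>\<^sup>c(\<tau>\<^sup>x\<sigma>\<^sup>b)\<^sup>-\<^sup>1\<close>, which is \<open>\<tau>\<^sup>y\<^sup>-\<^sup>x\<close> if \<open>b = c\<close> and \<open>\<tau>\<^sup>x\<^sup>+\<^sup>y\<sigma>\<close> otherwise.
\<close>

definition dihedral_verts :: "int \<Rightarrow> (int \<times> bool) set" where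
  "dihedral_verts p = {0..<p} \<times> UNIV"

definition dihedral_adj :: "int \<Rightarrow> int set \<Rightarrow> int set \<Rightarrow> int \<times> bool \<Rightarrow> int \<times> bool \<Rightarrow> bool" where
  "dihedral_adj p R T u v \<longleftrightarrow>
    (if snd u = snd v then (fst v - fst u) mod p \<in> R else (fst u + fst v) mod p \<in> T)"

text \<open>Inversion negates the exponent of a rotation but fixes every reflection, so only
  \<open>R\<close> has to be symmetric; 0 is barred from \<open>R\<close> as the identity, while 0
  in \<open>T\<close> stands for sigma and is allowed.\<close>

definition dihedral_sets :: "int \<Rightarrow> (int set \<times> int set) set" where
  "dihedral_sets p = {(R, T). R \<subseteq> {1..<p} \<and> (\<lambda>x. - x mod p) ` R = R \<and> T \<subseteq> {0..<p}}"

definition graph_isomorphic :: "int \<Rightarrow> int set \<times> int set \<Rightarrow> int set \<times> int set \<Rightarrow> bool" where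
  "graph_isomorphic p = (\<lambda>(R, T) (R', T'). \<exists>\<phi>. bij_betw \<phi> (dihedral_verts p) (dihedral_verts p) \<and>
    (\<forall>u\<in>dihedral_verts p. \<forall>v\<in>dihedral_verts p.
      dihedral_adj p R T u v \<longleftrightarrow> dihedral_adj p R' T' (\<phi> u) (\<phi> v)))"

text \<open>The effect of the automorphism \<open>\<tau> \<mapsto> \<tau>\<^sup>a\<close>, \<open>\<sigma> \<mapsto> \<tau>\<^sup>b\<sigma>\<close> on a connection set.\<close>

definition affine_image :: "int \<Rightarrow> int \<times> int \<Rightarrow> int set \<times> int set \<Rightarrow> int set \<times> int set" where
  "affine_image p = (\<lambda>(a, b) (R, T). ((\<lambda>x. a * x mod p) ` R, (\<lambda>x. (a * x + b) mod p) ` T))"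

text \<open>Membership transfer gives only one inclusion directly; the other needs a preimage of
  each \<open>y\<close>, namely \<open>e * (y - b)\<close> with \<open>e\<close> the inverse of
  \<open>a\<close> modulo \<open>p\<close>.\<close>

lemma residue_affine_image_eqI:
  fixes p a b :: int
  assumes p: "prime p" and a: "a \<in> {1..<p}" and R: "R \<subseteq> {0..<p}" "R' \<subseteq> {0..<p}"
    and iff: "\<And>x. x \<in> {0..<p} \<Longrightarrow> x \<in> R \<longleftrightarrow> (a * x + b) mod p \<in> R'"
  shows "R' = (\<lambda>x. (a * x + b) mod p) ` R"
proof
  show "(\<lambda>x. (a * x + b) mod p) ` R \<subseteq> R'" using iff R(1) by blast
  show "R' \<subseteq> (\<lambda>x. (a * x + b) mod p) ` R"
  proof
    fix y assume y: "y \<in> R'"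
    have "\<not> p dvd a" using a by (auto dest: zdvd_imp_le)
    then have "coprime a p" using prime_imp_coprime[OF p] by (simp add: coprime_commute)
    then obtain e where e: "[a * e = 1] (mod p)" by (auto dest: cong_solve_coprime_int)
    define x where "x = (e * (y - b)) mod p"
    have x: "x \<in> {0..<p}" using p by (simp add: x_def prime_gt_0_int)
    have "[(a * e) * (y - b) = 1 * (y - b)] (mod p)" using e by (rule cong_scalar_right)
    then have "[a * x = y - b] (mod p)" by (simp add: x_def cong_def mod_simps mult.assoc)
    then have "[a * x + b = (y - b) + b] (mod p)" by (intro cong_add) auto
    then have "(a * x + b) mod p = y" using y R(2) by (auto simp: cong_def)
    then show "y \<in> (\<lambda>x. (a * x + b) mod p) ` R" using iff[OF x] y by force
  qed
qed

text \<open>The Cayley isomorphism property of cyclic groups of prime order. A permutation commuting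
  with the full cycle \<open>x \<mapsto> x + 1\<close> is determined by its value at 0 and so is a
  power of it, which supplies the centralizer condition; a normalizing isomorphism is then affine,
  and its translation part cancels in differences.\<close>

lemma circulant_isomorphic_imp_multiple:
  fixes p :: nat and R R' :: "int set"
  assumes p: "prime p" and R: "R \<subseteq> {0..<int p}" "R' \<subseteq> {0..<int p}"
    and \<phi>: "bij_betw \<phi> {0..<int p} {0..<int p}"
    and iso: "\<And>x y. x \<in> {0..<int p} \<Longrightarrow> y \<in> {0..<int p} \<Longrightarrow>
      (y - x) mod int p \<in> R \<longleftrightarrow> (\<phi> y - \<phi> x) mod int p \<in> R'"
  shows "\<exists>a\<in>{1..<int p}. R' = (\<lambda>x. a * x mod int p) ` R"
proof -
  let ?V = "{0..<int p}"
  have p1: "p > 1" using p by (rule prime_gt_1_nat)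
  define \<rho> where "\<rho> x = (if x \<in> ?V then (x + 1) mod int p else x)" for x
  have \<rho>_V: "\<rho> x \<in> ?V" if "x \<in> ?V" for x using that p1 by (simp add: \<rho>_def)
  have \<rho>_pow: "(\<rho> ^^ m) x = (x + int m) mod int p" if "x \<in> ?V" for m x
  proof (induction m)
    case (Suc m)
    then show ?case using p1 by (simp add: \<rho>_def mod_simps algebra_simps)
  qed (use that in simp)
  have \<rho>_out: "(\<rho> ^^ m) x = x" if "x \<notin> ?V" for m x
    using that by (induction m) (auto simp: \<rho>_def)
  have period: "\<rho> ^^ p = id"
  proof
    show "(\<rho> ^^ p) x = id x" for x
      by (cases "x \<in> ?V") (simp_all add: \<rho>_pow \<rho>_out del: atLeastLessThan_iff, simp)
  qed
  have \<rho>: "\<rho> permutes ?V"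
  proof (rule bij_imp_permutes)
    have "inj \<rho>"
    proof (rule injI)
      fix x y assume "\<rho> x = \<rho> y"
      then have "(\<rho> ^^ (p - 1)) (\<rho> x) = (\<rho> ^^ (p - 1)) (\<rho> y)" by simp
      moreover have "(\<rho> ^^ (p - 1)) (\<rho> z) = z" for z
        using fun_cong[OF period, of z] p1 by (cases p) (simp_all add: funpow_swap1)
      ultimately show "x = y" by simp
    qed
    then show "bij_betw \<rho> ?V ?V"
      using \<rho>_V by (intro bij_betw_imageI endo_inj_surj) (auto intro: inj_on_subset)
  qed (auto simp: \<rho>_def)
  have "\<rho> 0 \<noteq> 0" using p1 by (simp add: \<rho>_def)
  then have "\<rho> \<noteq> id" by auto
  have inv: "((\<rho> y - \<rho> x) mod int p \<in> Q) = ((y - x) mod int p \<in> Q)" if "x \<in> ?V" "y \<in> ?V" for x y Q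
    using that by (simp add: \<rho>_def mod_simps)
  obtain \<psi> c where \<psi>: "\<psi> permutes ?V"
    "\<And>x y. x \<in> ?V \<Longrightarrow> y \<in> ?V \<Longrightarrow> (y - x) mod int p \<in> R \<longleftrightarrow> (\<psi> y - \<psi> x) mod int p \<in> R'"
    "0 < c" "c < p" "\<And>m v. \<psi> ((\<rho> ^^ m) v) = (\<rho> ^^ (c * m)) (\<psi> v)"
  proof (rule isomorphism_normalizing_rotation[where V = ?V and p = p and \<rho> = \<rho> and \<phi> = \<phi>
        and E = "\<lambda>x y. (y - x) mod int p \<in> R" and E' = "\<lambda>x y. (y - x) mod int p \<in> R'"])
    show "\<exists>k. x = \<rho> ^^ k" if x: "x permutes ?V" and comm: "x \<circ> \<rho> = \<rho> \<circ> x" for x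
    proof
      have x0: "x 0 \<in> ?V" using permutes_in_image[OF x] p1 by simp
      show "x = \<rho> ^^ nat (x 0)"
      proof
        fix v
        show "x v = (\<rho> ^^ nat (x 0)) v"
        proof (cases "v \<in> ?V")
          case True
          then have "x v = x ((\<rho> ^^ nat v) 0)" using p1 by (simp add: \<rho>_pow)
          also have "\<dots> = (\<rho> ^^ nat v) (x 0)" using comm by (rule funpow_comp_commute)
          also have "\<dots> = (\<rho> ^^ nat (x 0)) v" using x0 True by (simp add: \<rho>_pow add.commute)
          finally show ?thesis .
        next
          case False
          then show ?thesis using x \<rho>_out by (auto simp: permutes_def)
        qed
      qed
    qed
  qed (use p \<rho> period \<open>\<rho> \<noteq> id\<close> inv \<phi> iso in auto)
  have \<psi>0: "\<psi> 0 \<in> ?V" using permutes_in_image[OF \<psi>(1)] p1 by simp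
  have \<psi>_eq: "\<psi> x = (\<psi> 0 + int c * x) mod int p" if "x \<in> ?V" for x
    using \<psi>(5)[of "nat x" 0] that \<psi>0 p1 by (simp add: \<rho>_pow)
  have "x \<in> R \<longleftrightarrow> (int c * x + 0) mod int p \<in> R'" if "x \<in> ?V" for x
    using \<psi>(2)[of 0 x] that p1 \<psi>0 by (simp add: \<psi>_eq[OF that] mod_simps)
  then have "R' = (\<lambda>x. (int c * x + 0) mod int p) ` R"
    using p \<psi>(3,4) R by (intro residue_affine_image_eqI) auto
  then show ?thesis using \<psi>(3,4) by (intro bexI[of _ "int c"]) auto
qed

section \<open>Isomorphisms for a reflection set that is neither empty nor full\<close>

context
  fixes p :: nat
  assumes p: "prime p" and odd: "odd p"
begin

private abbreviation (input) "V \<equiv> dihedral_verts (int p)"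

text \<open>Right multiplication by tau, which moves reflections backwards because sigma tau is the
  inverse of tau times sigma. Right multiplications preserve the quotient of two elements and hence
  every Cayley graph. Outside \<open>V\<close> the map is the identity, as \<open>permutes\<close>
  demands.\<close>

private definition \<rho> :: "int \<times> bool \<Rightarrow> int \<times> bool" where
  "\<rho> v = (if v \<in> V then ((fst v + (if snd v then -1 else 1)) mod int p, snd v) else v)"

private lemma p1: "p > 1"
  using p by (rule prime_gt_1_nat)

private lemma in_V: "(x, b) \<in> V \<longleftrightarrow> x \<in> {0..<int p}"
  by (simp add: dihedral_verts_def)

private lemma \<rho>_pow:
  assumes "x \<in> {0..<int p}"
  shows "(\<rho> ^^ m) (x, b) = ((x + (if b then - int m else int m)) mod int p, b)"
proof (induction m)
  case (Suc m)
  then show ?case using p1 by (simp add: \<rho>_def in_V mod_simps algebra_simps)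
qed (use assms in simp)

private lemma \<rho>_out: "v \<notin> V \<Longrightarrow> (\<rho> ^^ m) v = v"
  by (induction m) (auto simp: \<rho>_def)

private lemma \<rho>_period: "\<rho> ^^ p = id"
proof
  fix v :: "int \<times> bool"
  obtain x b where v: "v = (x, b)" by force
  show "(\<rho> ^^ p) v = id v"
  proof (cases "v \<in> V")
    case True
    then show ?thesis by (simp add: v \<rho>_pow in_V)
  qed (simp add: \<rho>_out)
qed

private lemma \<rho>_permutes: "\<rho> permutes V"
proof (rule bij_imp_permutes)
  have "inj \<rho>"
  proof (rule injI)
    fix x y assume "\<rho> x = \<rho> y"
    then have "(\<rho> ^^ (p - 1)) (\<rho> x) = (\<rho> ^^ (p - 1)) (\<rho> y)" by simp
    moreover have "(\<rho> ^^ (p - 1)) (\<rho> z) = z" for z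
      using fun_cong[OF \<rho>_period, of z] p1 by (cases p) (simp_all add: funpow_swap1)
    ultimately show "x = y" by simp
  qed
  moreover have "finite V" by (simp add: dihedral_verts_def)
  moreover have "\<rho> ` V \<subseteq> V" using p1 by (auto simp: \<rho>_def in_V)
  ultimately show "bij_betw \<rho> V V"
    by (intro bij_betw_imageI endo_inj_surj) (auto intro: inj_on_subset)
qed (simp add: \<rho>_def)

private lemma \<rho>_adj:
  assumes "u \<in> V" "v \<in> V"
  shows "dihedral_adj (int p) R T (\<rho> u) (\<rho> v) \<longleftrightarrow> dihedral_adj (int p) R T u v"
  using assms by (cases u; cases v) (simp add: dihedral_adj_def \<rho>_def mod_simps)

text \<open>
  A permutation that commutes with \<open>\<rho>\<close> up to a power acts affinely on both halves, because \<open>\<rho>\<close> is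
  transitive on each of them.
\<close>
private lemma semilinear_map:
  assumes \<psi>: "\<psi> permutes V" and semi: "\<And>m v. \<psi> ((\<rho> ^^ m) v) = (\<rho> ^^ (c * m)) (\<psi> v)"
    and c: "0 < c" "c < p"
  obtains s t \<beta> where "s \<in> {0..<int p}" "t \<in> {0..<int p}"
    "\<And>x. x \<in> {0..<int p} \<Longrightarrow> \<psi> (x, False) = ((s + (if \<beta> then -1 else 1) * int c * x) mod int p, \<beta>)"
    "\<And>x. x \<in> {0..<int p} \<Longrightarrow> \<psi> (x, True) = ((t + (if \<beta> then -1 else 1) * int c * x) mod int p, \<not> \<beta>)"
proof -
  obtain s \<beta> where s: "\<psi> (0, False) = (s, \<beta>)" by force
  obtain t \<gamma> where t: "\<psi> (0, True) = (t, \<gamma>)" by force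
  have st: "s \<in> {0..<int p}" "t \<in> {0..<int p}"
    using permutes_in_image[OF \<psi>, of "(0, False)"] permutes_in_image[OF \<psi>, of "(0, True)"] s t p1
    by (simp_all add: in_V)
  have F: "\<psi> (x, False) = ((s + (if \<beta> then -1 else 1) * int c * x) mod int p, \<beta>)"
    if "x \<in> {0..<int p}" for x
    using semi[of "nat x" "(0, False)"] that s st p1 by (simp add: \<rho>_pow)
  have T: "\<psi> (x, True) = ((t + (if \<gamma> then 1 else -1) * int c * x) mod int p, \<gamma>)"
    if "x \<in> {0..<int p}" for x
  proof -
    \<comment> \<open>On reflections \<open>\<rho>\<close> decreases the exponent, so
      \<open>(x, True)\<close> is reached from \<open>(0, True)\<close> after \<open>p - x\<close>
      steps.\<close>
    have "\<psi> (x, True) = (\<rho> ^^ (c * nat (int p - x))) (t, \<gamma>)"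
      using semi[of "nat (int p - x)" "(0, True)"] that t st p1 by (simp add: \<rho>_pow mod_simps)
    also have "\<dots> = ((t + (if \<gamma> then - (int c * (int p - x)) else int c * (int p - x))) mod int p, \<gamma>)"
      using that by (simp add: \<rho>_pow[OF st(2)])
    also have "(t + (if \<gamma> then - (int c * (int p - x)) else int c * (int p - x))) mod int p
        = (t + (if \<gamma> then 1 else -1) * int c * x) mod int p"
      by (auto simp: mod_eq_dvd_iff algebra_simps)
    finally show ?thesis .
  qed
  \<comment> \<open>If both halves landed in the same one, \<open>\<psi>\<close> could not be
    injective: the slope is invertible modulo \<open>p\<close>, so the image of the first half alone
    already contains the image of \<open>(0, True)\<close>.\<close>
  have "\<gamma> \<noteq> \<beta>"
  proof
    assume "\<gamma> = \<beta>"
    define a where "a = (if \<beta> then -1 else 1) * int c"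
    have "\<not> int p dvd a" using c by (auto simp: a_def dest: zdvd_imp_le)
    moreover have "prime (int p)" using p by simp
    ultimately have "coprime a (int p)" using prime_imp_coprime coprime_commute by blast
    then obtain e where e: "[a * e = 1] (mod int p)" by (auto dest: cong_solve_coprime_int)
    define x where "x = (e * (t - s)) mod int p"
    have x: "x \<in> {0..<int p}" using p1 by (simp add: x_def)
    have "[(a * e) * (t - s) = 1 * (t - s)] (mod int p)" using e by (rule cong_scalar_right)
    then have "[a * x = t - s] (mod int p)" by (simp add: x_def cong_def mod_simps mult.assoc)
    then have "[s + a * x = s + (t - s)] (mod int p)" by (intro cong_add) auto
    then have "\<psi> (x, False) = \<psi> (0, True)"
      using F[OF x] t st \<open>\<gamma> = \<beta>\<close> by (simp add: a_def cong_def)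
    then show False using permutes_inj[OF \<psi>] by (auto dest: injD)
  qed
  then have "\<gamma> = (\<not> \<beta>)" by auto
  then show ?thesis using that[of s t \<beta>] st F T by auto
qed

text \<open>The point is the centralizer of \<open>\<rho>\<close>: an automorphism of period
  \<open>p\<close> commuting with it shifts the halves by some \<open>s\<close> and
  \<open>t\<close>, and it is a power of \<open>\<rho>\<close> exactly when \<open>s + t\<close>
  vanishes modulo \<open>p\<close>. A nonzero \<open>s + t\<close> would be a shift preserving
  \<open>T\<close>, which \<open>T_nontriv\<close> excludes.\<close>

lemma isomorphic_imp_affine_nontrivial:
  assumes R: "R \<subseteq> {0..<int p}" "R' \<subseteq> {0..<int p}" and T: "T \<subseteq> {0..<int p}" "T' \<subseteq> {0..<int p}"
    and T_nontriv: "T \<noteq> {}" "T \<noteq> {0..<int p}"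
    and iso: "graph_isomorphic (int p) (R, T) (R', T')"
  shows "\<exists>a\<in>{1..<int p}. \<exists>b\<in>{0..<int p}. (R', T') = affine_image (int p) (a, b) (R, T)"
proof -
  let ?E = "dihedral_adj (int p)"
  obtain \<phi> where \<phi>: "bij_betw \<phi> V V"
    "\<And>u v. u \<in> V \<Longrightarrow> v \<in> V \<Longrightarrow> ?E R T u v \<longleftrightarrow> ?E R' T' (\<phi> u) (\<phi> v)"
    using iso by (auto simp: graph_isomorphic_def)
  obtain \<psi> c where \<psi>: "\<psi> permutes V"
    "\<And>u v. u \<in> V \<Longrightarrow> v \<in> V \<Longrightarrow> ?E R T u v \<longleftrightarrow> ?E R' T' (\<psi> u) (\<psi> v)"
    "0 < c" "c < p" "\<And>m v. \<psi> ((\<rho> ^^ m) v) = (\<rho> ^^ (c * m)) (\<psi> v)"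
  proof (rule isomorphism_normalizing_rotation[where V = V and p = p and \<rho> = \<rho> and \<phi> = \<phi>
        and E = "?E R T" and E' = "?E R' T'"])
    have "\<rho> (0, False) \<noteq> (0, False)" using p1 by (simp add: \<rho>_def in_V)
    then show "\<rho> \<noteq> id" by auto
    show "finite V" by (simp add: dihedral_verts_def)
    show "\<exists>k. x = \<rho> ^^ k"
      if x: "x permutes V" and aut: "\<And>u v. u \<in> V \<Longrightarrow> v \<in> V \<Longrightarrow> ?E R T (x u) (x v) \<longleftrightarrow> ?E R T u v"
        and comm: "x \<circ> \<rho> = \<rho> \<circ> x" and ord: "x ^^ p = id" for x
    proof -
      obtain s t \<beta> where st: "s \<in> {0..<int p}" "t \<in> {0..<int p}"
        and xF: "\<And>y. y \<in> {0..<int p} \<Longrightarrow> x (y, False) = ((s + (if \<beta> then -1 else 1) * int 1 * y) mod int p, \<beta>)"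
        and xT: "\<And>y. y \<in> {0..<int p} \<Longrightarrow> x (y, True) = ((t + (if \<beta> then -1 else 1) * int 1 * y) mod int p, \<not> \<beta>)"
        by (rule semilinear_map[OF x, of 1]) (use funpow_comp_commute[OF comm] p1 in auto)
      \<comment> \<open>An odd power of a map exchanging the halves still exchanges them, whereas
        the \<open>p\<close>-th power is the identity.\<close>
      have "\<not> \<beta>"
      proof
        assume \<beta>: \<beta>
        have flip: "snd (x v) \<longleftrightarrow> \<not> snd v" if "v \<in> V" for v
          using that xF xT \<beta> by (cases v; cases "snd v") (auto simp: in_V)
        have "(x ^^ n) (0, False) \<in> V \<and> (snd ((x ^^ n) (0, False)) \<longleftrightarrow> odd n)" for n
        proof (induction n)
          case 0
          then show ?case using p1 by (simp add: in_V)
        next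
          case (Suc n)
          then show ?case using flip permutes_in_image[OF x] by simp
        qed
        from this[of p] show False using ord odd by simp
      qed
      then have xF: "x (y, False) = ((y + s) mod int p, False)" and xT: "x (y, True) = ((y + t) mod int p, True)"
        if "y \<in> {0..<int p}" for y
        using xF[OF that] xT[OF that] by (simp_all add: add.commute)
      have "int p dvd (s + t)"
      proof (rule ccontr)
        assume nd: "\<not> int p dvd (s + t)"
        have "T = {} \<or> T = {0..<int p}"
        proof (rule shift_invariant_residues_trivial[OF _ nd T(1)])
          \<comment> \<open>The edge between \<open>(0, False)\<close> and \<open>(y, True)\<close>
            is governed by the sum \<open>y\<close>, the edge between their images by
            \<open>y + s + t\<close>.\<close>
          show "y \<in> T \<longleftrightarrow> (y + (s + t)) mod int p \<in> T" if "y \<in> {0..<int p}" for y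
            using aut[of "(0, False)" "(y, True)"] that p1 st
            by (simp add: in_V xF xT dihedral_adj_def mod_simps algebra_simps)
        qed (use p in simp)
        then show False using T_nontriv by blast
      qed
      \<comment> \<open>With \<open>t\<close> congruent to \<open>- s\<close>, the second half moves
        by \<open>- s\<close>, which is the direction in which \<open>\<rho>\<close> runs
        there.\<close>
      have "x = \<rho> ^^ nat s"
      proof
        fix v :: "int \<times> bool"
        obtain y b where v: "v = (y, b)" by force
        show "x v = (\<rho> ^^ nat s) v"
        proof (cases "y \<in> {0..<int p}")
          case True
          have "(y + t) mod int p = (y - s) mod int p"
            using \<open>int p dvd (s + t)\<close> by (simp add: mod_eq_dvd_iff add.commute)
          then show ?thesis using xF[OF True] xT[OF True] \<rho>_pow[OF True] st by (cases b) (auto simp: v)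
        next
          case False
          then have "v \<notin> V" by (simp add: v in_V)
          then show ?thesis using x by (simp add: \<rho>_out permutes_not_in)
        qed
      qed
      then show ?thesis by blast
    qed
  qed (use p \<rho>_permutes \<rho>_period \<rho>_adj \<phi> in auto)
  obtain s t \<beta> where st: "s \<in> {0..<int p}" "t \<in> {0..<int p}"
    and \<psi>F: "\<And>x. x \<in> {0..<int p} \<Longrightarrow> \<psi> (x, False) = ((s + (if \<beta> then -1 else 1) * int c * x) mod int p, \<beta>)"
    and \<psi>T: "\<And>x. x \<in> {0..<int p} \<Longrightarrow> \<psi> (x, True) = ((t + (if \<beta> then -1 else 1) * int c * x) mod int p, \<not> \<beta>)"
    using semilinear_map[OF \<psi>(1,5,3,4)] by metis
  \<comment> \<open>If \<open>\<psi>\<close> exchanges the halves, the multiplier is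
    \<open>- c\<close>, since \<open>\<rho>\<close> runs in opposite directions on them. Edges
    between the halves depend on the sum of the coordinates, so the translation part for
    \<open>T'\<close> is \<open>s + t\<close>.\<close>
  define a where "a = (if \<beta> then -1 else 1) * int c mod int p"
  define b where "b = (s + t) mod int p"
  have "\<not> int p dvd (if \<beta> then -1 else 1) * int c" using \<psi>(3,4) by (auto dest: zdvd_imp_le)
  then have "a \<noteq> 0" by (auto simp: a_def mod_eq_0_iff_dvd)
  moreover have "0 \<le> a" "a < int p" using p1 by (simp_all only: a_def pos_mod_sign pos_mod_bound of_nat_0_less_iff)
  ultimately have a: "a \<in> {1..<int p}" by simp
  have b: "b \<in> {0..<int p}" using p1 by (simp add: b_def)
  have "x \<in> R \<longleftrightarrow> (a * x + 0) mod int p \<in> R'" if "x \<in> {0..<int p}" for x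
  proof -
    have "x \<in> R \<longleftrightarrow> ?E R T (0, False) (x, False)" using that by (simp add: dihedral_adj_def)
    also have "\<dots> \<longleftrightarrow> ?E R' T' (\<psi> (0, False)) (\<psi> (x, False))" using \<psi>(2) that p1 by (simp add: in_V)
    also have "\<dots> \<longleftrightarrow> (a * x + 0) mod int p \<in> R'"
      using \<psi>F[OF that] \<psi>F[of 0] p1 by (simp add: dihedral_adj_def a_def mod_simps)
    finally show ?thesis .
  qed
  then have R': "R' = (\<lambda>x. (a * x + 0) mod int p) ` R"
    using p a R by (intro residue_affine_image_eqI) auto
  have "x \<in> T \<longleftrightarrow> (a * x + b) mod int p \<in> T'" if "x \<in> {0..<int p}" for x
  proof -
    have "x \<in> T \<longleftrightarrow> ?E R T (0, False) (x, True)" using that by (simp add: dihedral_adj_def)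
    also have "\<dots> \<longleftrightarrow> ?E R' T' (\<psi> (0, False)) (\<psi> (x, True))" using \<psi>(2) that p1 by (simp add: in_V)
    also have "\<dots> \<longleftrightarrow> (s + (t + (if \<beta> then -1 else 1) * int c * x)) mod int p \<in> T'"
      using \<psi>T[OF that] \<psi>F[of 0] p1 by (simp add: dihedral_adj_def mod_simps)
    also have "(s + (t + (if \<beta> then -1 else 1) * int c * x)) mod int p = (a * x + b) mod int p"
    proof -
      have "[a * x + b = (if \<beta> then -1 else 1) * int c * x + (s + t)] (mod int p)"
        unfolding a_def b_def by (intro cong_add cong_mult) (simp_all add: cong_def)
      then show ?thesis by (simp add: cong_def algebra_simps)
    qed
    finally show ?thesis .
  qed
  then have "T' = (\<lambda>x. (a * x + b) mod int p) ` T"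
    using p a T by (intro residue_affine_image_eqI) auto
  then show ?thesis using a b R' by (intro bexI[of _ a] bexI[of _ b]) (auto simp: affine_image_def)
qed

end

section \<open>Empty and full reflection sets, and the affine criterion\<close>

lemma affine_bij_betw_residues:
  fixes p a b :: int
  assumes "prime p" "a \<in> {1..<p}"
  shows "bij_betw (\<lambda>x. (a * x + b) mod p) {0..<p} {0..<p}"
proof -
  have "{0..<p} = (\<lambda>x. (a * x + b) mod p) ` {0..<p}"
    using assms by (intro residue_affine_image_eqI) (auto simp: prime_gt_0_int)
  then show ?thesis
    by (metis bij_betw_def eq_card_imp_inj_on finite_atLeastLessThan_int)
qed

text \<open>With \<open>T\<close> empty the graph consists of two copies of the circulant graph of
  \<open>R\<close> without edges between them. Once \<open>T'\<close> is known to be empty as well,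
  a nonempty \<open>R\<close> makes each copy connected, so \<open>\<phi>\<close> carries a half
  onto a half and the result for circulant graphs applies.\<close>

lemma isomorphic_imp_affine_empty:
  fixes p :: nat
  assumes p: "prime p" and odd: "odd p"
    and R: "R \<subseteq> {1..<int p}" "R' \<subseteq> {1..<int p}" and T': "T' \<subseteq> {0..<int p}"
    and iso: "graph_isomorphic (int p) (R, {}) (R', T')"
  shows "T' = {} \<and> (\<exists>a\<in>{1..<int p}. R' = (\<lambda>x. a * x mod int p) ` R)"
proof -
  let ?E = "dihedral_adj (int p)"
  let ?V = "dihedral_verts (int p)"
  let ?Z = "{0..<int p}"
  have p1: "p > 1" using p by (rule prime_gt_1_nat)
  have in_V: "(x, b) \<in> ?V \<longleftrightarrow> x \<in> ?Z" for x b by (simp add: dihedral_verts_def)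
  obtain \<phi> where \<phi>: "bij_betw \<phi> ?V ?V"
    "\<And>u v. u \<in> ?V \<Longrightarrow> v \<in> ?V \<Longrightarrow> ?E R {} u v \<longleftrightarrow> ?E R' T' (\<phi> u) (\<phi> v)"
    using iso by (auto simp: graph_isomorphic_def)
  define \<theta> where "\<theta> = inv_into ?V \<phi>"
  have \<theta>_V: "\<theta> v \<in> ?V" and \<phi>_\<theta>: "\<phi> (\<theta> v) = v" if "v \<in> ?V" for v
    using \<phi>(1) that by (auto simp: \<theta>_def bij_betw_def inv_into_into f_inv_into_f)
  have \<phi>_V: "\<phi> v \<in> ?V" and \<theta>_\<phi>: "\<theta> (\<phi> v) = v" if "v \<in> ?V" for v
    using \<phi>(1) that by (auto simp: \<theta>_def bij_betw_def)
  have "T' = {}"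
  proof (rule ccontr)
    assume "T' \<noteq> {}"
    then obtain t where t: "t \<in> T'" by blast
    \<comment> \<open>The neighbour along \<open>t\<close> is a fixed-point-free involution, but it would preserve a half of odd size.\<close>
    define k where "k v = ((t - fst v) mod int p, \<not> snd v)" for v :: "int \<times> bool"
    define j where "j v = \<theta> (k (\<phi> v))" for v
    have k_V: "k v \<in> ?V" for v using p1 by (simp add: k_def in_V)
    have kk: "k (k v) = v" if "v \<in> ?V" for v
      using that by (cases v) (simp add: k_def in_V mod_simps)
    have k_adj: "?E R' T' v (k v)" if "v \<in> ?V" for v
      using that t T' by (cases v) (auto simp: k_def dihedral_adj_def mod_simps)
    have j_V: "j v \<in> ?V" for v using \<theta>_V k_V by (simp add: j_def)
    have j_snd: "snd (j v) = snd v" if "v \<in> ?V" for v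
    proof -
      have "?E R' T' (\<phi> v) (\<phi> (j v))" using k_adj[OF \<phi>_V[OF that]] \<phi>_\<theta>[OF k_V] by (simp add: j_def)
      then have "?E R {} v (j v)" using \<phi>(2)[OF that j_V] by simp
      then show ?thesis by (simp add: dihedral_adj_def split: if_splits)
    qed
    have jj: "j (j v) = v" if "v \<in> ?V" for v
      using that by (simp add: j_def \<phi>_\<theta> k_V kk \<phi>_V \<theta>_\<phi>)
    have j_ne: "j v \<noteq> v" if "v \<in> ?V" for v
    proof
      assume "j v = v"
      then have "k (\<phi> v) = \<phi> v" using \<phi>_\<theta>[OF k_V] by (metis j_def)
      then show False by (metis k_def snd_conv)
    qed
    let ?X = "?Z \<times> {False}"
    have X_V: "v \<in> ?V" if "v \<in> ?X" for v using that by (auto simp: in_V)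
    have "[card ?X = card {v \<in> ?X. j v = v}] (mod 2)"
    proof (rule card_cong_card_fixed_points)
      show "j v \<in> ?X" if "v \<in> ?X" for v
        using j_V[of v] j_snd[OF X_V[OF that]] that by (cases "j v") (auto simp: in_V)
      show "(j ^^ 2) v = v" if "v \<in> ?X" for v
        using jj[OF X_V[OF that]] by (simp add: numeral_2_eq_2)
    qed auto
    also have "{v \<in> ?X. j v = v} = {}" using j_ne X_V by blast
    finally show False using odd by (simp add: card_cartesian_product cong_def odd_iff_mod_2_eq_one)
  qed
  moreover have "\<exists>a\<in>{1..<int p}. R' = (\<lambda>x. a * x mod int p) ` R"
  \<comment> \<open>Without edges \<open>\<phi>\<close> may scatter a half, so this case is settled
    directly.\<close>
  proof (cases "R = {}")
    case True
    have "r \<notin> R'" for r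
    proof
      assume r: "r \<in> R'"
      then have V: "(0, False) \<in> ?V" "(r, False) \<in> ?V" using R p1 by (auto simp: in_V)
      have "?E R' T' (0, False) (r, False)" using r R by (auto simp: dihedral_adj_def)
      then have "?E R {} (\<theta> (0, False)) (\<theta> (r, False))"
        using \<phi>(2)[OF \<theta>_V[OF V(1)] \<theta>_V[OF V(2)]] by (simp add: \<phi>_\<theta> V)
      then show False using True by (simp add: dihedral_adj_def split: if_splits)
    qed
    then have "R' = {}" by blast
    then show ?thesis using True p1 by (intro bexI[of _ 1]) auto
  next
    case False
    then obtain r where r: "r \<in> R" by blast
    \<comment> \<open>\<open>M\<close> collects the vertices of the first half sent to the same side
      as \<open>(0, False)\<close>. Steps by \<open>r\<close> follow edges, and the target graph has
      no edges between the sides, so \<open>M\<close> is invariant under a nonzero shift; it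
      contains 0.\<close>
    define M where "M = {x \<in> ?Z. snd (\<phi> (x, False)) = snd (\<phi> (0, False))}"
    have "M = {} \<or> M = ?Z"
    proof (rule shift_invariant_residues_trivial)
      show "prime (int p)" using p by simp
      have "0 < r" "r < int p" using r R(1) by auto
      then show "\<not> int p dvd r" by (simp add: zdvd_not_zless)
      show "M \<subseteq> ?Z" by (auto simp: M_def)
      show "x \<in> M \<longleftrightarrow> (x + r) mod int p \<in> M" if x: "x \<in> ?Z" for x
      proof -
        have V: "(x, False) \<in> ?V" "((x + r) mod int p, False) \<in> ?V" using x p1 by (auto simp: in_V)
        have "?E R {} (x, False) ((x + r) mod int p, False)"
          using r R by (auto simp: dihedral_adj_def mod_simps)
        then have "?E R' T' (\<phi> (x, False)) (\<phi> ((x + r) mod int p, False))" using \<phi>(2)[OF V] by simp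
        then have "snd (\<phi> (x, False)) = snd (\<phi> ((x + r) mod int p, False))"
          using \<open>T' = {}\<close> by (simp add: dihedral_adj_def split: if_splits)
        then show ?thesis using x p1 by (simp add: M_def)
      qed
    qed
    moreover have "0 \<in> M" using p1 by (simp add: M_def)
    ultimately have M: "M = ?Z" by blast
    have side: "snd (\<phi> (x, False)) = snd (\<phi> (0, False))" if "x \<in> ?Z" for x
    proof -
      have "x \<in> M" using that M by simp
      then show ?thesis by (simp add: M_def)
    qed
    define \<psi> where "\<psi> x = fst (\<phi> (x, False))" for x
    have "inj_on \<psi> ?Z"
    proof (rule inj_onI)
      fix x y assume xy: "x \<in> ?Z" "y \<in> ?Z" "\<psi> x = \<psi> y"
      then have "\<phi> (x, False) = \<phi> (y, False)" using side[OF xy(1)] side[OF xy(2)] by (simp add: \<psi>_def prod_eq_iff)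
      moreover have "(x, False) \<in> ?V" "(y, False) \<in> ?V" using xy in_V by blast+
      ultimately have "(x, False) = (y, False)" using \<phi>(1) by (meson bij_betw_def inj_onD)
      then show "x = y" by simp
    qed
    moreover have "\<psi> ` ?Z \<subseteq> ?Z"
    proof
      fix y assume "y \<in> \<psi> ` ?Z"
      then obtain x where "x \<in> ?Z" "y = \<psi> x" by blast
      then show "y \<in> ?Z" using \<phi>_V[of "(x, False)"]
        by (cases "\<phi> (x, False)") (simp add: in_V \<psi>_def)
    qed
    ultimately have "bij_betw \<psi> ?Z ?Z" by (simp add: bij_betw_def endo_inj_surj)
    moreover have "(y - x) mod int p \<in> R \<longleftrightarrow> (\<psi> y - \<psi> x) mod int p \<in> R'"
      if "x \<in> ?Z" "y \<in> ?Z" for x y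
      using \<phi>(2)[of "(x, False)" "(y, False)"] that side[OF that(1)] side[OF that(2)]
      by (simp add: in_V dihedral_adj_def \<psi>_def)
    moreover have "R \<subseteq> ?Z" "R' \<subseteq> ?Z" using R by auto
    ultimately show ?thesis using circulant_isomorphic_imp_multiple[OF p] by blast
  qed
  ultimately show ?thesis by blast
qed

lemma residue_multiple_bij_betw:
  fixes p a :: int
  assumes "prime p" "a \<in> {1..<p}"
  shows "bij_betw (\<lambda>x. a * x mod p) {1..<p} {1..<p}"
proof -
  have "bij_betw (\<lambda>x. a * x mod p) {0..<p} {0..<p}"
    using affine_bij_betw_residues[OF assms, of 0] by simp
  then have "bij_betw (\<lambda>x. a * x mod p) ({0..<p} - {0}) ({0..<p} - {0})"
    by (rule bij_betw_DiffI) (use assms in auto)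
  moreover have "{0..<p} - {0} = {1..<p}" by auto
  ultimately show ?thesis by simp
qed

text \<open>This turns a full \<open>T\<close> into an empty one. A loop would correspond to the
  residue 0, hence \<open>R\<close> is complemented within the nonzero residues and \<open>T\<close>
  within all of them.\<close>

lemma graph_isomorphic_complement:
  fixes p :: int
  assumes p: "p > 0" and R: "R \<subseteq> {1..<p}" "R' \<subseteq> {1..<p}"
    and iso: "graph_isomorphic p (R, T) (R', T')"
  shows "graph_isomorphic p ({1..<p} - R, {0..<p} - T) ({1..<p} - R', {0..<p} - T')"
proof -
  have compl: "dihedral_adj p ({1..<p} - R) ({0..<p} - T) u v \<longleftrightarrow> u \<noteq> v \<and> \<not> dihedral_adj p R T u v"
    if R: "R \<subseteq> {1..<p}" and uv: "u \<in> dihedral_verts p" "v \<in> dihedral_verts p" for R T u v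
  proof (cases "snd u = snd v")
    case True
    have "m \<in> {1..<p} \<longleftrightarrow> m \<noteq> 0" if "0 \<le> m" "m < p" for m using that by auto
    then have "(fst v - fst u) mod p \<in> {1..<p} \<longleftrightarrow> (fst v - fst u) mod p \<noteq> 0"
      using p by simp
    also have "\<dots> \<longleftrightarrow> u \<noteq> v"
    proof -
      have "(fst v - fst u) mod p = 0 \<longleftrightarrow> fst v mod p = fst u mod p"
        by (simp add: mod_eq_dvd_iff mod_eq_0_iff_dvd)
      then show ?thesis using True uv by (auto simp: dihedral_verts_def prod_eq_iff)
    qed
    finally show ?thesis using True by (auto simp: dihedral_adj_def)
  next
    case False
    then show ?thesis using p by (auto simp: dihedral_adj_def)
  qed
  obtain \<phi> where \<phi>: "bij_betw \<phi> (dihedral_verts p) (dihedral_verts p)"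
    and E: "\<And>u v. u \<in> dihedral_verts p \<Longrightarrow> v \<in> dihedral_verts p \<Longrightarrow>
      dihedral_adj p R T u v \<longleftrightarrow> dihedral_adj p R' T' (\<phi> u) (\<phi> v)"
    using iso by (auto simp: graph_isomorphic_def)
  have "\<phi> u \<in> dihedral_verts p" if "u \<in> dihedral_verts p" for u
    using that \<phi> by (auto simp: bij_betw_def)
  moreover have "\<phi> u = \<phi> v \<longleftrightarrow> u = v" if "u \<in> dihedral_verts p" "v \<in> dihedral_verts p" for u v
    using that \<phi> by (auto simp: bij_betw_def inj_on_def)
  ultimately show ?thesis unfolding graph_isomorphic_def prod.case
    using \<phi> by (intro exI[of _ \<phi>]) (simp add: compl R E)
qed

lemma mod_inner_right: "(a * (x mod p) + b) mod p = (a * x + b) mod (p :: int)"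
  by (metis mod_add_left_eq mod_mult_right_eq)

text \<open>The group automorphism with parameters \<open>a\<close> and \<open>b\<close> acts on
  vertices as \<open>f\<close>, which shifts only reflections by \<open>b\<close>. An edge between
  the halves has exactly one reflection as endpoint, so the sum picks up \<open>b\<close> once, and
  in a difference within a half it cancels.\<close>

lemma graph_isomorphic_affine_image:
  fixes p :: int
  assumes p: "prime p" and R: "R \<subseteq> {0..<p}" and T: "T \<subseteq> {0..<p}" and a: "a \<in> {1..<p}"
  shows "graph_isomorphic p (R, T) (affine_image p (a, b) (R, T))"
proof -
  have p0: "p > 0" using p by (simp add: prime_gt_0_int)
  define f where "f v = ((a * fst v + (if snd v then b else 0)) mod p, snd v)" for v :: "int \<times> bool"
  have inj: "x = y" if "x \<in> {0..<p}" "y \<in> {0..<p}" "(a * x + c) mod p = (a * y + c) mod p" for x y c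
    by (rule inj_onD[OF bij_betw_imp_inj_on[OF affine_bij_betw_residues[OF p a, of c]] that(3,1,2)])
  have "inj_on f (dihedral_verts p)"
  proof (rule inj_onI)
    fix u v assume uv: "u \<in> dihedral_verts p" "v \<in> dihedral_verts p" "f u = f v"
    define c where "c = (if snd u then b else 0)"
    have snd: "snd u = snd v" using uv(3) by (simp add: f_def)
    then have "(a * fst u + c) mod p = (a * fst v + c) mod p"
      using arg_cong[OF uv(3), of fst] unfolding f_def c_def fst_conv by (simp only:)
    then have "fst u = fst v" using inj[of "fst u" "fst v" c] uv by (auto simp: dihedral_verts_def)
    with snd show "u = v" by (simp add: prod_eq_iff)
  qed
  moreover have "f ` dihedral_verts p \<subseteq> dihedral_verts p"
    using p0 by (auto simp: f_def dihedral_verts_def)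
  moreover have "finite (dihedral_verts p)" by (simp add: dihedral_verts_def)
  ultimately have "bij_betw f (dihedral_verts p) (dihedral_verts p)"
    by (simp add: bij_betw_def endo_inj_surj)
  moreover have mem: "z mod p \<in> Q \<longleftrightarrow> (a * z + c) mod p \<in> (\<lambda>x. (a * x + c) mod p) ` Q"
    if "Q \<subseteq> {0..<p}" for z c Q
  proof
    assume "z mod p \<in> Q"
    then have "(a * (z mod p) + c) mod p \<in> (\<lambda>x. (a * x + c) mod p) ` Q" by blast
    then show "(a * z + c) mod p \<in> (\<lambda>x. (a * x + c) mod p) ` Q" by (simp only: mod_inner_right)
  next
    assume "(a * z + c) mod p \<in> (\<lambda>x. (a * x + c) mod p) ` Q"
    then obtain x where x: "x \<in> Q" "(a * (z mod p) + c) mod p = (a * x + c) mod p"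
      unfolding mod_inner_right by blast
    moreover have "z mod p \<in> {0..<p}" using p0 by simp
    ultimately have "z mod p = x" using inj[of "z mod p" x c] that by blast
    then show "z mod p \<in> Q" using x by simp
  qed
  have "dihedral_adj p R T u v \<longleftrightarrow>
      dihedral_adj p ((\<lambda>x. a * x mod p) ` R) ((\<lambda>x. (a * x + b) mod p) ` T) (f u) (f v)" for u v
  proof (cases "snd u = snd v")
    case True
    have "(fst (f v) - fst (f u)) mod p = (a * (fst v - fst u) + 0) mod p"
      using True by (simp add: f_def mod_simps algebra_simps)
    then show ?thesis using True mem[OF R, of "fst v - fst u" 0]
      by (simp add: dihedral_adj_def f_def)
  next
    case False
    have "(fst (f u) + fst (f v)) mod p
        = ((a * fst u + (if snd u then b else 0)) + (a * fst v + (if snd v then b else 0))) mod p"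
      unfolding f_def fst_conv by (rule mod_add_eq)
    also have "\<dots> = (a * (fst u + fst v) + b) mod p" using False by (auto simp: algebra_simps)
    finally show ?thesis using False mem[OF T, of "fst u + fst v" b]
      by (simp add: dihedral_adj_def f_def)
  qed
  ultimately show ?thesis by (auto simp: graph_isomorphic_def affine_image_def)
qed

text \<open>The Cayley isomorphism property of the dihedral group: an isomorphism of graphs can be
  replaced by one induced by a group automorphism.\<close>

theorem graph_isomorphic_iff_affine:
  fixes p :: nat
  assumes p: "prime p" and odd: "odd p"
    and R: "R \<subseteq> {1..<int p}" "R' \<subseteq> {1..<int p}" and T: "T \<subseteq> {0..<int p}" "T' \<subseteq> {0..<int p}"
  shows "graph_isomorphic (int p) (R, T) (R', T') \<longleftrightarrow>
    (\<exists>a\<in>{1..<int p}. \<exists>b\<in>{0..<int p}. (R', T') = affine_image (int p) (a, b) (R, T))"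
proof
  have p': "prime (int p)" using p by simp
  have RZ: "R \<subseteq> {0..<int p}" using R by auto
  assume "\<exists>a\<in>{1..<int p}. \<exists>b\<in>{0..<int p}. (R', T') = affine_image (int p) (a, b) (R, T)"
  then show "graph_isomorphic (int p) (R, T) (R', T')"
    using graph_isomorphic_affine_image[OF p' RZ T(1)] by metis
next
  have p': "prime (int p)" using p by simp
  have p0: "int p > 0" using p' by (rule prime_gt_0_int)
  have RZ: "R \<subseteq> {0..<int p}" "R' \<subseteq> {0..<int p}" using R by auto
  assume iso: "graph_isomorphic (int p) (R, T) (R', T')"
  consider "T = {}" | "T = {0..<int p}" | "T \<noteq> {}" "T \<noteq> {0..<int p}" by blast
  then show "\<exists>a\<in>{1..<int p}. \<exists>b\<in>{0..<int p}. (R', T') = affine_image (int p) (a, b) (R, T)"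
  proof cases
    case 1
    then obtain a where "a \<in> {1..<int p}" "R' = (\<lambda>x. a * x mod int p) ` R" "T' = {}"
      using isomorphic_imp_affine_empty[OF p odd R T(2)] iso by blast
    then show ?thesis using 1 p0 by (intro bexI[of _ a] bexI[of _ 0]) (auto simp: affine_image_def)
  next
    case 2
    have "graph_isomorphic (int p) ({1..<int p} - R, {}) ({1..<int p} - R', {0..<int p} - T')"
      using graph_isomorphic_complement[OF p0 R iso] 2 by simp
    then have "{0..<int p} - T' = {} \<and>
        (\<exists>a\<in>{1..<int p}. {1..<int p} - R' = (\<lambda>x. a * x mod int p) ` ({1..<int p} - R))"
      by (intro isomorphic_imp_affine_empty[OF p odd]) auto
    then obtain a where a: "a \<in> {1..<int p}" "T' = {0..<int p}"
      "{1..<int p} - R' = (\<lambda>x. a * x mod int p) ` ({1..<int p} - R)"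
      using T(2) by blast
    \<comment> \<open>Multiplication by \<open>a\<close> permutes the nonzero residues, so the
      relation between the complements carries over to \<open>R\<close> and
      \<open>R'\<close>.\<close>
    note bij = residue_multiple_bij_betw[OF p' a(1)]
    have surj: "(\<lambda>x. a * x mod int p) ` {1..<int p} = {1..<int p}"
      using bij by (rule bij_betw_imp_surj_on)
    have "(\<lambda>x. a * x mod int p) ` ({1..<int p} - R) = {1..<int p} - (\<lambda>x. a * x mod int p) ` R"
      using inj_on_image_set_diff[OF bij_betw_imp_inj_on[OF bij] Diff_subset R(1)] unfolding surj .
    moreover have "(\<lambda>x. a * x mod int p) ` R \<subseteq> {1..<int p}"
      using image_mono[OF R(1), of "\<lambda>x. a * x mod int p"] unfolding surj .
    ultimately have "R' = (\<lambda>x. a * x mod int p) ` R" using a(3) R(2) by blast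
    moreover have "(\<lambda>x. (a * x + 0) mod int p) ` {0..<int p} = {0..<int p}"
      using affine_bij_betw_residues[OF p' a(1)] by (rule bij_betw_imp_surj_on)
    ultimately show ?thesis using 2 a(1,2) p0
      by (intro bexI[of _ a] bexI[of _ 0]) (auto simp: affine_image_def)
  next
    case 3
    then show ?thesis using isomorphic_imp_affine_nontrivial[OF p odd RZ T _ _ iso] by blast
  qed
qed

section \<open>Coordinates on the presented dihedral group\<close>

text \<open>Only the relations are assumed here: the multiplication rule for \<open>elt\<close>
  follows from them, but distinct coordinates might still name the same element. That they do not is
  added by \<open>dihedral_coordinates\<close>.\<close>

locale dihedral_relators = group G for G (structure) +
  fixes t s and n :: nat
  assumes t: "t \<in> carrier G" and s: "s \<in> carrier G"
    and t_pow: "t [^] n = \<one>" and s_sq: "s \<otimes> s = \<one>" and s_t_s: "s \<otimes> t \<otimes> s = inv t"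
begin

definition elt :: "int \<times> bool \<Rightarrow> 'a" where
  "elt v = t [^] fst v \<otimes> (if snd v then s else \<one>)"

lemma elt_closed [simp]: "elt v \<in> carrier G"
  using t s by (simp add: elt_def)

lemma s_commute: "s \<otimes> t [^] (x :: int) = t [^] (- x) \<otimes> s"
proof -
  have pow: "s \<otimes> t [^] (m :: nat) = inv (t [^] m) \<otimes> s" for m
  proof (induction m)
    case 0
    then show ?case using s by simp
  next
    case (Suc m)
    have "s \<otimes> t = inv t \<otimes> s"
    proof -
      have "inv t \<otimes> s = s \<otimes> t \<otimes> (s \<otimes> s)" using s t by (simp add: s_t_s[symmetric] m_assoc)
      then show ?thesis using s t by (simp add: s_sq)
    qed
    have "s \<otimes> t [^] Suc m = (s \<otimes> t [^] m) \<otimes> t" using s t by (simp add: m_assoc)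
    also have "\<dots> = inv (t [^] m) \<otimes> (s \<otimes> t)" using Suc s t by (simp add: m_assoc)
    also have "\<dots> = (inv (t [^] m) \<otimes> inv t) \<otimes> s" using \<open>s \<otimes> t = inv t \<otimes> s\<close> s t by (simp add: m_assoc)
    also have "inv (t [^] m) \<otimes> inv t = inv (t \<otimes> t [^] m)" using t by (simp add: inv_mult_group)
    also have "t \<otimes> t [^] m = t [^] Suc m" using t nat_pow_Suc2 by simp
    finally show ?case .
  qed
  show ?thesis
  proof (cases "x \<ge> 0")
    case True
    then obtain m where x: "x = int m" by (rule nonneg_int_cases)
    show ?thesis using pow[of m] int_pow_neg[OF t, of "int m"] by (simp only: x int_pow_int)
  next
    case False
    define m where "m = nat (- x)"
    have x: "x = - int m" using False by (simp add: m_def)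
    have "t [^] m \<otimes> s = s \<otimes> inv (t [^] m)"
    proof -
      have "inv (t [^] m) \<otimes> s \<otimes> inv (t [^] m) = s"
        using pow[of m, symmetric] s t by (simp add: m_assoc)
      then have "t [^] m \<otimes> (inv (t [^] m) \<otimes> s \<otimes> inv (t [^] m)) = t [^] m \<otimes> s" by simp
      then show ?thesis using s t by (simp add: m_assoc[symmetric])
    qed
    then show ?thesis using int_pow_neg[OF t, of "int m"] by (simp only: x int_pow_int minus_minus)
  qed
qed

lemma elt_mult: "elt (x, b) \<otimes> elt (y, c) = elt (x + (if b then - y else y), b \<noteq> c)"
proof (cases b)
  case True
  have "elt (x, b) \<otimes> elt (y, c) = t [^] x \<otimes> (s \<otimes> t [^] y) \<otimes> (if c then s else \<one>)"
    using True s t by (simp add: elt_def m_assoc)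
  also have "\<dots> = t [^] x \<otimes> t [^] (- y) \<otimes> (s \<otimes> (if c then s else \<one>))"
    unfolding s_commute using s t by (simp add: m_assoc)
  also have "t [^] x \<otimes> t [^] (- y) = t [^] (x + - y)" by (rule int_pow_mult[OF t, symmetric])
  finally show ?thesis using True s by (simp add: elt_def s_sq)
next
  case False
  then show ?thesis using s t by (simp add: elt_def m_assoc int_pow_mult)
qed

lemma elt_0: "elt (0, False) = \<one>"
  by (simp add: elt_def)

lemma elt_cong:
  assumes "x mod int n = y mod int n"
  shows "elt (x, b) = elt (y, b)"
proof -
  obtain k where k: "x = y + int n * k"
    using assms by (metis mod_eqE)
  have "t [^] (int n * k) = (t [^] int n) [^] k" using t by (simp add: int_pow_pow)
  also have "\<dots> = \<one>" using t_pow by (simp add: int_pow_int)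
  finally have "t [^] x = t [^] y" using t by (simp add: k int_pow_mult)
  then show ?thesis by (simp add: elt_def)
qed

lemma elt_mod: "elt (x mod int n, b) = elt (x, b)"
  by (rule elt_cong) simp

lemma inv_elt: "inv (elt (x, b)) = elt (if b then x else - x, b)"
  by (rule inv_equality) (simp_all add: elt_mult elt_0)

lemma elt_mult_inv:
  "elt v \<otimes> inv (elt u) =
    elt (if snd u = snd v then ((fst v - fst u) mod int n, False) else ((fst u + fst v) mod int n, True))"
  by (cases u; cases v) (auto simp: inv_elt elt_mult elt_mod add.commute)

end

text \<open>Left multiplication by a generator on the elements \<open>\<tau>\<^sup>x\<sigma>\<^sup>b\<close>, encoded as pairs \<open>(x, b)\<close>.\<close>

fun dihedral_letter :: "int \<Rightarrow> dihedral_gen \<times> bool \<Rightarrow> int \<times> bool \<Rightarrow> int \<times> bool" where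
  "dihedral_letter n (Tau, True) (x, b) = ((x + 1) mod n, b)"
| "dihedral_letter n (Tau, False) (x, b) = ((x - 1) mod n, b)"
| "dihedral_letter n (Sigma, c) (x, b) = ((- x) mod n, \<not> b)"

lemma dihedral_letter_in_verts:
  "n > 0 \<Longrightarrow> dihedral_letter n l v \<in> dihedral_verts n"
  by (cases "(n, l, v)" rule: dihedral_letter.cases) (auto simp: dihedral_verts_def)

lemma foldr_dihedral_letter_in_verts:
  "n > 0 \<Longrightarrow> v \<in> dihedral_verts n \<Longrightarrow> foldr (dihedral_letter n) w v \<in> dihedral_verts n"
  by (induction w) (auto simp: dihedral_letter_in_verts)

lemma foldr_dihedral_letter_Tau:
  assumes "x \<in> {0..<n}"
  shows "foldr (dihedral_letter n) (replicate m (Tau, True)) (x, b) = ((x + int m) mod n, b)"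
  using assms by (induction m) (auto simp: mod_simps algebra_simps)

text \<open>Words act on reduced coordinates, and the action respects cancellation and all
  relations. It can therefore tell classes of words apart, which bounds the order of the presented
  group from below. Reduced coordinates matter because a letter and its inverse cancel only up to
  reduction modulo \<open>n\<close>.\<close>

lemma pres_eq_dihedral_imp_same_action:
  assumes "pres_eq (dihedral_relations n) u v" "n > 0" "z \<in> dihedral_verts (int n)"
  shows "foldr (dihedral_letter (int n)) u z = foldr (dihedral_letter (int n)) v z"
  using assms
proof (induction arbitrary: z rule: pres_eq.induct)
  case (pres_cancel u x b v)
  have "dihedral_letter (int n) (x, b) (dihedral_letter (int n) (x, \<not> b) y) = y"
    if "y \<in> dihedral_verts (int n)" for y
    using that by (cases y; cases x; cases b) (auto simp: dihedral_verts_def mod_simps)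
  then show ?case using foldr_dihedral_letter_in_verts pres_cancel by simp
next
  case (pres_rel l r u v)
  have "foldr (dihedral_letter (int n)) l y = foldr (dihedral_letter (int n)) r y"
    if "y \<in> dihedral_verts (int n)" for y
  proof (cases y)
    case (Pair x b)
    with that have "x \<in> {0..<int n}" by (simp add: dihedral_verts_def)
    then show ?thesis using pres_rel(1)
      by (auto simp: dihedral_relations_def Pair foldr_dihedral_letter_Tau numeral_2_eq_2 mod_simps
          simp del: foldr_replicate)
  qed
  then show ?case using foldr_dihedral_letter_in_verts pres_rel by simp
qed simp_all

section \<open>Normal forms in the presented dihedral group\<close>

context
  fixes n :: nat
  assumes n: "n > 0"
begin

private abbreviation (input) "D \<equiv> dihedral_group n"
private abbreviation (input) "cls \<equiv> pres_class (dihedral_relations n)"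

lemma group_dihedral_group: "group (dihedral_group n)"
  by (simp add: dihedral_group_def group_presented_group)

private lemma cls_mult: "cls u \<otimes>\<^bsub>D\<^esub> cls v = cls (u @ v)"
  by (simp add: dihedral_group_def presented_group_mult)

private lemma cls_closed: "cls u \<in> carrier D"
  by (simp add: dihedral_group_def presented_group_carrier)

private lemma cls_one: "\<one>\<^bsub>D\<^esub> = cls []"
  by (simp add: dihedral_group_def presented_group_one)

private lemma cls_rel: "(l, r) \<in> dihedral_relations n \<Longrightarrow> cls l = cls r"
  using pres_rel[of l r "dihedral_relations n" "[]" "[]"] by (simp add: pres_class_eq_iff)

private lemma cls_pow: "cls [(x, True)] [^]\<^bsub>D\<^esub> (m :: nat) = cls (replicate m (x, True))"
proof (induction m)
  case (Suc m)
  then show ?case by (simp add: nat_pow_def cls_mult replicate_append_same)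
qed (simp add: nat_pow_def cls_one)

private lemma cls_inv: "inv\<^bsub>D\<^esub> cls [(x, True)] = cls [(x, False)]"
proof (rule group.inv_equality[OF group_dihedral_group])
  show "cls [(x, False)] \<otimes>\<^bsub>D\<^esub> cls [(x, True)] = \<one>\<^bsub>D\<^esub>"
    using pres_cancel[of "dihedral_relations n" "[]" x False "[]"]
    by (simp add: cls_mult cls_one pres_class_eq_iff)
qed (simp_all add: cls_closed)

lemma dihedral_relators_dihedral_group:
  "dihedral_relators (dihedral_group n) (cls [(Tau, True)]) (cls [(Sigma, True)]) n"
proof -
  interpret group "dihedral_group n" by (rule group_dihedral_group)
  show ?thesis
  proof
    show "cls [(Tau, True)] [^]\<^bsub>D\<^esub> n = \<one>\<^bsub>D\<^esub>"
      unfolding cls_pow cls_one by (rule cls_rel) (simp add: dihedral_relations_def)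
    show "cls [(Sigma, True)] \<otimes>\<^bsub>D\<^esub> cls [(Sigma, True)] = \<one>\<^bsub>D\<^esub>"
      unfolding cls_mult cls_one by (rule cls_rel) (simp add: dihedral_relations_def numeral_2_eq_2)
    show "cls [(Sigma, True)] \<otimes>\<^bsub>D\<^esub> cls [(Tau, True)] \<otimes>\<^bsub>D\<^esub> cls [(Sigma, True)] = inv\<^bsub>D\<^esub> cls [(Tau, True)]"
      unfolding cls_mult cls_inv by (rule cls_rel) (simp add: dihedral_relations_def)
  qed (simp_all add: cls_closed)
qed

private lemma elt_eq_cls:
  assumes "x \<ge> 0"
  shows "dihedral_relators.elt D (cls [(Tau, True)]) (cls [(Sigma, True)]) (x, b)
    = cls (replicate (nat x) (Tau, True) @ (if b then [(Sigma, True)] else []))"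
proof -
  interpret dihedral_relators D "cls [(Tau, True)]" "cls [(Sigma, True)]" n
    by (rule dihedral_relators_dihedral_group)
  have "cls [(Tau, True)] [^]\<^bsub>D\<^esub> x = cls (replicate (nat x) (Tau, True))"
    using assms by (simp add: int_pow_def2 cls_pow)
  then show ?thesis by (simp add: elt_def cls_mult cls_one)
qed

text \<open>Injectivity rests on the action of words: the normal-form word of \<open>z\<close> sends
  \<open>(0, False)\<close> to \<open>z\<close>, so equal classes have equal coordinates.
  Surjectivity is an induction on words, as products of elements \<open>elt v\<close> are again of
  that form.\<close>

lemma elt_bij_betw_dihedral_group:
  "bij_betw (dihedral_relators.elt D (cls [(Tau, True)]) (cls [(Sigma, True)])) (dihedral_verts (int n)) (carrier D)"
proof -
  interpret dihedral_relators D "cls [(Tau, True)]" "cls [(Sigma, True)]" n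
    by (rule dihedral_relators_dihedral_group)
  have "inj_on elt (dihedral_verts (int n))"
  proof (rule inj_onI)
    fix u v assume uv: "u \<in> dihedral_verts (int n)" "v \<in> dihedral_verts (int n)" "elt u = elt v"
    define w where "w z = replicate (nat (fst z)) (Tau, True) @ (if snd z then [(Sigma, True)] else [])"
      for z :: "int \<times> bool"
    have cls_w: "elt z = cls (w z)" if "z \<in> dihedral_verts (int n)" for z
      using that elt_eq_cls by (cases z) (auto simp: dihedral_verts_def w_def)
    have act_w: "foldr (dihedral_letter (int n)) (w z) (0, False) = z" if "z \<in> dihedral_verts (int n)" for z
      using that n by (cases z) (auto simp: dihedral_verts_def w_def foldr_dihedral_letter_Tau
          simp del: foldr_replicate)
    have "pres_eq (dihedral_relations n) (w u) (w v)"
      using uv by (simp add: cls_w pres_class_eq_iff)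
    moreover have "(0, False) \<in> dihedral_verts (int n)" using n by (simp add: dihedral_verts_def)
    ultimately show "u = v"
      using pres_eq_dihedral_imp_same_action[of n "w u" "w v" "(0, False)"] n act_w uv by simp
  qed
  moreover have "elt ` dihedral_verts (int n) = carrier D"
  proof
    have word: "\<exists>v. cls w = elt v" for w
    proof (induction w)
      case Nil
      then show ?case using elt_0 cls_one by metis
    next
      case (Cons a w)
      obtain x b where a: "a = (x, b)" by force
      have "\<exists>v. cls [a] = elt v"
      proof (cases x)
        case Tau
        have "cls [(Tau, True)] = elt (1, False)" "cls [(Tau, False)] = elt (- 1, False)"
          using t by (simp_all add: elt_def cls_inv int_pow_neg cls_closed)
        then show ?thesis using Tau a by (cases b) auto
      next
        case Sigma
        have T: "cls [(Sigma, True)] = elt (0, True)" using s by (simp add: elt_def)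
        have "cls [(Sigma, False)] = inv\<^bsub>D\<^esub> elt (0, True)" by (simp only: T[symmetric] cls_inv)
        also have "\<dots> = elt (0, True)" by (simp only: inv_elt if_True)
        finally show ?thesis using Sigma a T by (cases b) auto
      qed
      then obtain u where u: "cls [a] = elt u" by blast
      obtain v where v: "cls w = elt v" using Cons by blast
      have "cls (a # w) = cls [a] \<otimes>\<^bsub>D\<^esub> cls w" by (simp add: cls_mult)
      also have "\<dots> = elt (fst u + (if snd u then - fst v else fst v), snd u \<noteq> snd v)"
        unfolding u v using elt_mult[of "fst u" "snd u" "fst v" "snd v"] by simp
      finally show ?case by blast
    qed
    show "carrier D \<subseteq> elt ` dihedral_verts (int n)"
    proof
      fix g assume "g \<in> carrier D"
      then obtain w where "g = cls w" by (auto simp: dihedral_group_def presented_group_carrier)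
      then obtain x b where "g = elt (x, b)" using word by (metis surj_pair)
      then have "g = elt (x mod int n, b)" by (simp add: elt_mod)
      moreover have "(x mod int n, b) \<in> dihedral_verts (int n)" using n by (simp add: dihedral_verts_def)
      ultimately show "g \<in> elt ` dihedral_verts (int n)" by blast
    qed
  qed auto
  ultimately show ?thesis by (simp add: bij_betw_def)
qed

end

section \<open>Transport of isomorphism classes to pairs of residue sets\<close>

lemma card_quotient_bij_betw:
  assumes f: "bij_betw f A B" and s: "s \<subseteq> B \<times> B"
    and iff: "\<And>x y. x \<in> A \<Longrightarrow> y \<in> A \<Longrightarrow> (f x, f y) \<in> s \<longleftrightarrow> (x, y) \<in> r" and r: "r \<subseteq> A \<times> A"
  shows "card (B // s) = card (A // r)"
proof -
  have cls: "s `` {f x} = f ` (r `` {x})" if x: "x \<in> A" for x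
  proof (intro Set.set_eqI iffI)
    fix z assume z: "z \<in> s `` {f x}"
    then obtain y where "y \<in> A" "z = f y" using s f by (auto simp: bij_betw_def)
    then show "z \<in> f ` (r `` {x})" using z iff[OF x] by auto
  next
    fix z assume "z \<in> f ` (r `` {x})"
    then obtain y where "(x, y) \<in> r" "z = f y" by blast
    then show "z \<in> s `` {f x}" using iff[OF x, of y] r by auto
  qed
  have "B // s = (`) f ` (A // r)"
  proof -
    have "B // s = (\<lambda>x. s `` {f x}) ` A"
      using f by (auto simp: quotient_def bij_betw_def)
    also have "\<dots> = (\<lambda>x. f ` (r `` {x})) ` A" using cls by (rule image_cong[OF refl])
    also have "\<dots> = (`) f ` (A // r)" by (auto simp: quotient_def)
    finally show ?thesis .
  qed
  moreover have "inj_on ((`) f) (A // r)"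
  proof (rule inj_on_subset)
    show "inj_on ((`) f) (Pow A)" using f by (simp add: bij_betw_def inj_on_image_Pow)
    show "A // r \<subseteq> Pow A" using r by (auto simp: quotient_def)
  qed
  ultimately show ?thesis by (simp add: card_image)
qed

definition graph_iso_rel :: "int \<Rightarrow> (int set \<times> int set) rel" where
  "graph_iso_rel n = {(X, Y) \<in> dihedral_sets n \<times> dihedral_sets n. graph_isomorphic n X Y}"

locale dihedral_coordinates = dihedral_relators +
  assumes n: "n > 0" and elt_bij: "bij_betw elt (dihedral_verts (int n)) (carrier G)"
begin

definition conn :: "int set \<times> int set \<Rightarrow> 'a set" where
  "conn X = elt ` (fst X \<times> {False} \<union> snd X \<times> {True})"

lemma elt_in_conn_iff:
  assumes "R \<subseteq> {0..<int n}" "T \<subseteq> {0..<int n}" "x \<in> {0..<int n}"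
  shows "elt (x, b) \<in> conn (R, T) \<longleftrightarrow> (if b then x \<in> T else x \<in> R)"
proof -
  have inj: "inj_on elt (dihedral_verts (int n))" using elt_bij by (rule bij_betw_imp_inj_on)
  have "R \<times> {False} \<union> T \<times> {True} \<subseteq> dihedral_verts (int n)"
    using assms by (auto simp: dihedral_verts_def)
  moreover have "(x, b) \<in> dihedral_verts (int n)" using assms by (simp add: dihedral_verts_def)
  ultimately have "elt (x, b) \<in> conn (R, T) \<longleftrightarrow> (x, b) \<in> R \<times> {False} \<union> T \<times> {True}"
    unfolding conn_def fst_conv snd_conv by (intro inj_on_image_mem_iff[OF inj])
  then show ?thesis by auto
qed

lemma cayley_graph_adj_iff:
  assumes "R \<subseteq> {0..<int n}" "T \<subseteq> {0..<int n}"
  shows "(elt u, elt v) \<in> parcs (cayley_graph G (conn (R, T))) \<longleftrightarrow> dihedral_adj (int n) R T u v"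
  using n by (simp add: cayley_graph_def elt_mult_inv dihedral_adj_def elt_in_conn_iff[OF assms])

lemma conn_connection_sets:
  assumes "X \<in> dihedral_sets (int n)"
  shows "conn X \<in> connection_sets G"
proof -
  obtain R T where X: "X = (R, T)" and R: "R \<subseteq> {1..<int n}" "(\<lambda>x. - x mod int n) ` R = R"
    and T: "T \<subseteq> {0..<int n}" using assms by (auto simp: dihedral_sets_def)
  have RZ: "R \<subseteq> {0..<int n}" using R by auto
  have "\<one> \<notin> conn X" using elt_in_conn_iff[OF RZ T, of 0 False] n R by (auto simp: X elt_0)
  moreover have "conn X \<subseteq> carrier G" by (auto simp: conn_def)
  moreover have "m_inv G ` conn X = conn X"
  proof -
    have conn_X: "conn X = (\<lambda>x. elt (x, False)) ` R \<union> (\<lambda>x. elt (x, True)) ` T"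
      by (auto simp: X conn_def)
    have "m_inv G ` conn X = (\<lambda>x. elt (- x mod int n, False)) ` R \<union> (\<lambda>x. elt (x, True)) ` T"
      by (simp add: conn_X image_Un image_image inv_elt elt_mod)
    also have "(\<lambda>x. elt (- x mod int n, False)) ` R = (\<lambda>x. elt (x, False)) ` R"
      using arg_cong[OF R(2), of "image (\<lambda>x. elt (x, False))"] by (simp add: image_image)
    also have "(\<lambda>x. elt (x, False)) ` R \<union> (\<lambda>x. elt (x, True)) ` T = conn X"
      by (rule conn_X[symmetric])
    finally show ?thesis .
  qed
  ultimately show ?thesis by (auto simp: connection_sets_def)
qed

lemma connection_sets_conn:
  assumes "S \<in> connection_sets G"
  shows "\<exists>X\<in>dihedral_sets (int n). S = conn X"
proof -
  have S: "S \<subseteq> carrier G" "\<one> \<notin> S" "m_inv G ` S = S" using assms by (auto simp: connection_sets_def)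
  define R where "R = {x \<in> {0..<int n}. elt (x, False) \<in> S}"
  define T where "T = {x \<in> {0..<int n}. elt (x, True) \<in> S}"
  have "S = conn (R, T)"
  proof (intro Set.set_eqI)
    fix g
    show "g \<in> S \<longleftrightarrow> g \<in> conn (R, T)"
    proof (cases "g \<in> carrier G")
      case True
      then have "g \<in> elt ` dihedral_verts (int n)" using bij_betw_imp_surj_on[OF elt_bij] by simp
      then obtain x b where g: "g = elt (x, b)" "x \<in> {0..<int n}"
        unfolding dihedral_verts_def by blast
      have "g \<in> conn (R, T) \<longleftrightarrow> (if b then x \<in> T else x \<in> R)"
        unfolding g(1) using g(2) by (intro elt_in_conn_iff) (auto simp: R_def T_def)
      then show ?thesis using g by (cases b) (auto simp: R_def T_def)
    next
      case False
      then show ?thesis using S by (auto simp: conn_def)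
    qed
  qed
  moreover have "(R, T) \<in> dihedral_sets (int n)"
  proof -
    have "0 \<notin> R" using S(2) by (auto simp: R_def elt_0)
    have "R \<subseteq> {1..<int n}"
    proof
      fix x assume x: "x \<in> R"
      then have "x \<noteq> 0" using \<open>0 \<notin> R\<close> by auto
      then show "x \<in> {1..<int n}" using x by (simp add: R_def)
    qed
    moreover have neg: "- x mod int n \<in> R" if "x \<in> R" for x
    proof -
      have "inv (elt (x, False)) \<in> S" using that S(3) by (auto simp: R_def)
      then show ?thesis using n by (simp add: R_def inv_elt elt_mod)
    qed
    moreover have "(\<lambda>x. - x mod int n) ` R = R"
    proof
      show "(\<lambda>x. - x mod int n) ` R \<subseteq> R" using neg by blast
      show "R \<subseteq> (\<lambda>x. - x mod int n) ` R"
      proof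
        fix x assume x: "x \<in> R"
        then have "x = - (- x mod int n) mod int n" by (auto simp: R_def mod_simps)
        then show "x \<in> (\<lambda>x. - x mod int n) ` R" using neg[OF x] by (rule image_eqI)
      qed
    qed
    moreover have "T \<subseteq> {0..<int n}" by (auto simp: T_def)
    ultimately show ?thesis by (simp add: dihedral_sets_def)
  qed
  ultimately show ?thesis by blast
qed

text \<open>Injectivity matters because the classes consist of graphs rather than connection sets:
  the neighbours of the identity recover \<open>R\<close> and \<open>T\<close>.\<close>

lemma cayley_graph_conn_bij_betw:
  "bij_betw (\<lambda>X. cayley_graph G (conn X)) (dihedral_sets (int n)) (cayley_graphs G)"
proof (rule bij_betw_imageI)
  show "(\<lambda>X. cayley_graph G (conn X)) ` dihedral_sets (int n) = cayley_graphs G"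
    unfolding cayley_graphs_def using conn_connection_sets connection_sets_conn by blast
  show "inj_on (\<lambda>X. cayley_graph G (conn X)) (dihedral_sets (int n))"
  proof (rule inj_onI)
    fix X Y assume X: "X \<in> dihedral_sets (int n)" and Y: "Y \<in> dihedral_sets (int n)"
      and eq: "cayley_graph G (conn X) = cayley_graph G (conn Y)"
    obtain R T R' T' where XY: "X = (R, T)" "Y = (R', T')" by force
    have RT: "R \<subseteq> {0..<int n}" "T \<subseteq> {0..<int n}" and RT': "R' \<subseteq> {0..<int n}" "T' \<subseteq> {0..<int n}"
      using X Y by (auto simp: XY dihedral_sets_def)
    have adj: "dihedral_adj (int n) R T u v \<longleftrightarrow> dihedral_adj (int n) R' T' u v" for u v
      using cayley_graph_adj_iff[OF RT] cayley_graph_adj_iff[OF RT'] eq by (simp add: XY)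
    have "x \<in> R \<longleftrightarrow> x \<in> R'" "x \<in> T \<longleftrightarrow> x \<in> T'" if "x \<in> {0..<int n}" for x
      using that adj[of "(0, False)" "(x, False)"] adj[of "(0, False)" "(x, True)"]
      by (simp_all add: dihedral_adj_def)
    then show "X = Y" using RT RT' unfolding XY by blast
  qed
qed

lemma cayley_iso_conn_iff:
  assumes X: "X \<in> dihedral_sets (int n)" and Y: "Y \<in> dihedral_sets (int n)"
  shows "(cayley_graph G (conn X), cayley_graph G (conn Y)) \<in> cayley_iso G \<longleftrightarrow>
    graph_isomorphic (int n) X Y"
proof -
  let ?V = "dihedral_verts (int n)"
  obtain R T R' T' where XY: "X = (R, T)" "Y = (R', T')" by force
  have RT: "R \<subseteq> {0..<int n}" "T \<subseteq> {0..<int n}" and RT': "R' \<subseteq> {0..<int n}" "T' \<subseteq> {0..<int n}"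
    using X Y by (auto simp: XY dihedral_sets_def)
  let ?A = "parcs (cayley_graph G (conn X))" and ?B = "parcs (cayley_graph G (conn Y))"
  have in_graphs: "cayley_graph G (conn X) \<in> cayley_graphs G" "cayley_graph G (conn Y) \<in> cayley_graphs G"
    using X Y conn_connection_sets by (auto simp: cayley_graphs_def)
  have verts: "pverts (cayley_graph G S) = carrier G" for S by (simp add: cayley_graph_def)
  have A: "(elt u, elt v) \<in> ?A \<longleftrightarrow> dihedral_adj (int n) R T u v"
    and B: "(elt u, elt v) \<in> ?B \<longleftrightarrow> dihedral_adj (int n) R' T' u v" for u v
    using cayley_graph_adj_iff[OF RT] cayley_graph_adj_iff[OF RT'] by (simp_all add: XY)
  define \<iota> where "\<iota> = inv_into ?V elt"
  have \<iota>: "bij_betw \<iota> (carrier G) ?V" unfolding \<iota>_def using elt_bij by (rule bij_betw_inv_into)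
  have elt_\<iota>: "elt (\<iota> g) = g" if "g \<in> carrier G" for g
    unfolding \<iota>_def using elt_bij that by (rule bij_betw_inv_into_right)
  have \<iota>_elt: "\<iota> (elt v) = v" if "v \<in> ?V" for v
    unfolding \<iota>_def using elt_bij that by (rule bij_betw_inv_into_left)
  have \<iota>_V: "\<iota> g \<in> ?V" if "g \<in> carrier G" for g using \<iota> that by (rule bij_betw_apply)
  have "(cayley_graph G (conn X), cayley_graph G (conn Y)) \<in> cayley_iso G \<longleftrightarrow>
    (\<exists>f. bij_betw f (carrier G) (carrier G) \<and>
      (\<forall>g\<in>carrier G. \<forall>h\<in>carrier G. (g, h) \<in> ?A \<longleftrightarrow> (f g, f h) \<in> ?B))"
    using in_graphs
    by (simp add: cayley_iso_def verts
        digraph_iso_with_proj_iff[OF pair_wf_digraph_cayley_graphs pair_wf_digraph_cayley_graphs])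
  also have "\<dots> \<longleftrightarrow> graph_isomorphic (int n) X Y"
  proof
    assume "\<exists>f. bij_betw f (carrier G) (carrier G) \<and>
      (\<forall>g\<in>carrier G. \<forall>h\<in>carrier G. (g, h) \<in> ?A \<longleftrightarrow> (f g, f h) \<in> ?B)"
    then obtain f where f: "bij_betw f (carrier G) (carrier G)"
      and AB: "\<And>g h. g \<in> carrier G \<Longrightarrow> h \<in> carrier G \<Longrightarrow> (g, h) \<in> ?A \<longleftrightarrow> (f g, f h) \<in> ?B" by blast
    have "bij_betw (\<iota> \<circ> (f \<circ> elt)) ?V ?V"
      using bij_betw_trans[OF bij_betw_trans[OF elt_bij f] \<iota>] by (simp add: comp_assoc)
    moreover have "dihedral_adj (int n) R T u v \<longleftrightarrow>
        dihedral_adj (int n) R' T' ((\<iota> \<circ> (f \<circ> elt)) u) ((\<iota> \<circ> (f \<circ> elt)) v)" for u v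
    proof -
      have "f (elt u) \<in> carrier G" "f (elt v) \<in> carrier G"
        using f by (auto intro: bij_betw_apply)
      then show ?thesis using AB[of "elt u" "elt v"] A[of u v] B[of "\<iota> (f (elt u))" "\<iota> (f (elt v))"]
        by (simp add: elt_\<iota>)
    qed
    ultimately show "graph_isomorphic (int n) X Y" unfolding graph_isomorphic_def XY by auto
  next
    assume "graph_isomorphic (int n) X Y"
    then obtain \<phi> where \<phi>: "bij_betw \<phi> ?V ?V"
      and E: "\<And>u v. u \<in> ?V \<Longrightarrow> v \<in> ?V \<Longrightarrow>
        dihedral_adj (int n) R T u v \<longleftrightarrow> dihedral_adj (int n) R' T' (\<phi> u) (\<phi> v)"
      unfolding graph_isomorphic_def XY by auto
    have "bij_betw (elt \<circ> (\<phi> \<circ> \<iota>)) (carrier G) (carrier G)"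
      using bij_betw_trans[OF bij_betw_trans[OF \<iota> \<phi>] elt_bij] by (simp add: comp_assoc)
    moreover have "(g, h) \<in> ?A \<longleftrightarrow> ((elt \<circ> (\<phi> \<circ> \<iota>)) g, (elt \<circ> (\<phi> \<circ> \<iota>)) h) \<in> ?B"
      if "g \<in> carrier G" "h \<in> carrier G" for g h
      using E[OF \<iota>_V[OF that(1)] \<iota>_V[OF that(2)]] A[of "\<iota> g" "\<iota> h"] B[of "\<phi> (\<iota> g)" "\<phi> (\<iota> h)"] that
      by (simp add: elt_\<iota>)
    ultimately show "\<exists>f. bij_betw f (carrier G) (carrier G) \<and>
      (\<forall>g\<in>carrier G. \<forall>h\<in>carrier G. (g, h) \<in> ?A \<longleftrightarrow> (f g, f h) \<in> ?B)" by blast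
  qed
  finally show ?thesis .
qed

lemma card_cayley_graph_classes:
  "card (cayley_graphs G // cayley_iso G) = card (dihedral_sets (int n) // graph_iso_rel (int n))"
proof (rule card_quotient_bij_betw[OF cayley_graph_conn_bij_betw])
  show "cayley_iso G \<subseteq> cayley_graphs G \<times> cayley_graphs G" by (auto simp: cayley_iso_def)
  show "graph_iso_rel (int n) \<subseteq> dihedral_sets (int n) \<times> dihedral_sets (int n)"
    by (auto simp: graph_iso_rel_def)
qed (simp add: cayley_iso_conn_iff graph_iso_rel_def)

end

lemma card_dihedral_cayley_graph_classes:
  assumes "n > 0"
  shows "card (cayley_graphs (dihedral_group n) // cayley_iso (dihedral_group n))
    = card (dihedral_sets (int n) // graph_iso_rel (int n))"
proof -
  interpret dihedral_coordinates "dihedral_group n" "pres_class (dihedral_relations n) [(Tau, True)]"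
    "pres_class (dihedral_relations n) [(Sigma, True)]" n
    by (intro dihedral_coordinates.intro dihedral_relators_dihedral_group
        dihedral_coordinates_axioms.intro elt_bij_betw_dihedral_group assms)
  show ?thesis by (rule card_cayley_graph_classes)
qed

section \<open>Counting invariant sets of residues\<close>

text \<open>The shifts preserving \<open>X\<close> form a subgroup of the integers; containing
  \<open>i\<close>, \<open>j\<close> and \<open>n\<close>, it contains their gcd \<open>d\<close> by
  Bezout, so \<open>X\<close> is a union of classes modulo \<open>d\<close>, and every choice of
  classes occurs. Two shifts are treated at once because symmetric sets are also invariant under
  negation.\<close>

lemma card_shift_invariant_sets:
  fixes n i j :: nat
  assumes n: "n > 0"
  shows "card {X. X \<subseteq> {0..<int n} \<and> (\<lambda>x. (x + int i) mod int n) ` X = X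
      \<and> (\<lambda>x. (x + int j) mod int n) ` X = X} = 2 ^ gcd (gcd i j) n"
proof -
  let ?sh = "\<lambda>i x. (x + int i) mod int n"
  let ?F = "{X. X \<subseteq> {0..<int n} \<and> ?sh i ` X = X \<and> ?sh j ` X = X}"
  define d where "d = gcd (gcd i j) n"
  have d: "d > 0" "d dvd i" "d dvd j" "d dvd n" "d \<le> n"
    using n by (auto simp: d_def intro: dvd_trans[OF gcd_dvd1] dvd_imp_le)
  define P where "P Y = {x \<in> {0..<int n}. x mod int d \<in> Y}" for Y
  have P_F: "P Y \<in> ?F" for Y
  proof -
    have "?sh k ` P Y = P Y" if "d dvd k" for k
    proof (rule endo_inj_surj)
      show "finite (P Y)" by (rule finite_subset[of _ "{0..<int n}"]) (auto simp: P_def)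
      show "?sh k ` P Y \<subseteq> P Y"
      proof
        fix z assume "z \<in> ?sh k ` P Y"
        then obtain x where x: "x \<in> P Y" "z = (x + int k) mod int n" by blast
        have "z mod int d = (x + int k) mod int d" using d x(2) by (simp add: mod_mod_cancel)
        also have "\<dots> = x mod int d" using that by (simp add: mod_eq_dvd_iff)
        finally show "z \<in> P Y" using x n by (simp add: P_def)
      qed
      show "inj_on (?sh k) (P Y)"
      proof (rule inj_onI)
        fix x y assume "x \<in> P Y" "y \<in> P Y" "?sh k x = ?sh k y"
        then have "x mod int n = y mod int n" by (simp add: mod_eq_dvd_iff)
        then show "x = y" using \<open>x \<in> P Y\<close> \<open>y \<in> P Y\<close> by (simp add: P_def)
      qed
    qed
    then show ?thesis using d by (auto simp: P_def)
  qed
  have F_P: "X = P (X \<inter> {0..<int d})" if X: "X \<in> ?F" for X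
  proof -
    have X_sub: "X \<subseteq> {0..<int n}" using X by simp
    \<comment> \<open>Quantifying over all integers \<open>x\<close>, reduced only inside the
      membership test, makes closure of \<open>K\<close> under addition and negation
      immediate.\<close>
    define K where "K = {h. \<forall>x. x mod int n \<in> X \<longleftrightarrow> (x + h) mod int n \<in> X}"
    have K_shift: "int k \<in> K" if k: "?sh k ` X = X" for k
    proof -
      have "x mod int n \<in> X \<longleftrightarrow> (x + int k) mod int n \<in> X" for x
      proof
        assume "x mod int n \<in> X"
        then have "?sh k (x mod int n) \<in> ?sh k ` X" by (rule imageI)
        then show "(x + int k) mod int n \<in> X" unfolding k by (simp add: mod_simps)
      next
        assume "(x + int k) mod int n \<in> X"
        then have "(x + int k) mod int n \<in> ?sh k ` X" unfolding k .
        then obtain y where y: "y \<in> X" "(x + int k) mod int n = (y + int k) mod int n" by blast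
        then have "x mod int n = y mod int n" by (simp add: mod_eq_dvd_iff)
        also have "\<dots> = y" using y X_sub by auto
        finally show "x mod int n \<in> X" using y by simp
      qed
      then show ?thesis by (simp add: K_def)
    qed
    have K_n: "int n \<in> K" by (simp add: K_def)
    have K_add: "a + b \<in> K" if "a \<in> K" "b \<in> K" for a b
    proof -
      have "x mod int n \<in> X \<longleftrightarrow> (x + (a + b)) mod int n \<in> X" for x
      proof -
        have "x mod int n \<in> X \<longleftrightarrow> (x + a) mod int n \<in> X" using that by (simp only: K_def mem_Collect_eq)
        also have "\<dots> \<longleftrightarrow> (x + a + b) mod int n \<in> X" using that(2) unfolding K_def by blast
        finally show ?thesis by (simp only: add.assoc)
      qed
      then show ?thesis by (simp only: K_def mem_Collect_eq) blast
    qed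
    have K_neg: "- a \<in> K" if "a \<in> K" for a
    proof -
      have "x mod int n \<in> X \<longleftrightarrow> (x + - a) mod int n \<in> X" for x
      proof -
        have "(x + - a) mod int n \<in> X \<longleftrightarrow> (x + - a + a) mod int n \<in> X"
          using that unfolding K_def by blast
        then show ?thesis by simp
      qed
      then show ?thesis by (simp only: K_def mem_Collect_eq) blast
    qed
    have K_nat: "int m * a \<in> K" if "a \<in> K" for m a
    proof (induction m)
      case 0
      then show ?case by (simp add: K_def)
    next
      case (Suc m)
      then show ?case using K_add[OF that Suc] by (simp add: algebra_simps)
    qed
    have K_mult: "k * a \<in> K" if "a \<in> K" for k a
    proof (cases "k \<ge> 0")
      case True
      then show ?thesis using K_nat[OF that, of "nat k"] by simp
    next
      case False
      then show ?thesis using K_neg[OF K_nat[OF that, of "nat (- k)"]] by simp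
    qed
    obtain u v where uv: "u * int i + v * int j = gcd (int i) (int j)" using bezout_int by blast
    obtain u' v' where uv': "u' * gcd (int i) (int j) + v' * int n = gcd (gcd (int i) (int j)) (int n)"
      using bezout_int by blast
    have "int i \<in> K" "int j \<in> K" using X K_shift by auto
    then have "gcd (int i) (int j) \<in> K" unfolding uv[symmetric] by (intro K_add K_mult)
    then have "gcd (gcd (int i) (int j)) (int n) \<in> K" unfolding uv'[symmetric] by (intro K_add K_mult K_n)
    then have "int d \<in> K" by (simp add: d_def)
    have reduce: "x \<in> X \<longleftrightarrow> x mod int d \<in> X" if x: "x \<in> {0..<int n}" for x
    proof -
      have "- (x div int d) * int d \<in> K" using \<open>int d \<in> K\<close> by (rule K_mult)
      then have "x mod int n \<in> X \<longleftrightarrow> (x + - (x div int d) * int d) mod int n \<in> X"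
        unfolding K_def by blast
      also have "x + - (x div int d) * int d = x mod int d"
        by (simp add: minus_div_mult_eq_mod[symmetric])
      also have "(x mod int d) mod int n = x mod int d"
      proof (rule mod_pos_pos_trivial)
        show "0 \<le> x mod int d" using d(1) by simp
        have "x mod int d < int d" using d(1) by simp
        then show "x mod int d < int n" using d(5) by linarith
      qed
      also have "x mod int n = x" using x by simp
      finally show ?thesis .
    qed
    show ?thesis
    proof (intro Set.set_eqI)
      fix x
      show "x \<in> X \<longleftrightarrow> x \<in> P (X \<inter> {0..<int d})"
      proof (cases "x \<in> {0..<int n}")
        case True
        have "x mod int d \<in> {0..<int d}" using d(1) by simp
        then show ?thesis using reduce[OF True] True unfolding P_def by blast
      next
        case False
        then show ?thesis using X_sub unfolding P_def by blast
      qed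
    qed
  qed
  have P_inter: "P Y \<inter> {0..<int d} = Y" if "Y \<subseteq> {0..<int d}" for Y
  proof (intro Set.set_eqI iffI)
    fix y assume "y \<in> Y"
    then have "y \<in> {0..<int d}" using that by blast
    then show "y \<in> P Y \<inter> {0..<int d}" using \<open>y \<in> Y\<close> d(5) by (simp add: P_def)
  qed (auto simp: P_def)
  have "bij_betw P (Pow {0..<int d}) ?F"
  proof (rule bij_betwI[where g = "\<lambda>X. X \<inter> {0..<int d}"])
    show "P \<in> Pow {0..<int d} \<rightarrow> ?F" using P_F by (intro funcsetI)
    show "(\<lambda>X. X \<inter> {0..<int d}) \<in> ?F \<rightarrow> Pow {0..<int d}" by blast
    show "P Y \<inter> {0..<int d} = Y" if "Y \<in> Pow {0..<int d}" for Y using P_inter that by blast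
    show "P (X \<inter> {0..<int d}) = X" if "X \<in> ?F" for X using F_P[OF that] by (rule sym)
  qed
  then have "card ?F = card (Pow {0..<int d})" by (rule bij_betw_same_card[symmetric])
  also have "\<dots> = 2 ^ d" by (simp add: card_Pow)
  finally show ?thesis by (simp add: d_def)
qed

lemma card_invariant_sets_bij_betw:
  assumes f: "bij_betw f A B"
    and s: "\<And>x. x \<in> A \<Longrightarrow> s x \<in> A" "\<And>x. x \<in> A \<Longrightarrow> f (s x) = s' (f x)"
    and t: "\<And>x. x \<in> A \<Longrightarrow> t x \<in> A" "\<And>x. x \<in> A \<Longrightarrow> f (t x) = t' (f x)"
  shows "card {X. X \<subseteq> A \<and> s ` X = X \<and> t ` X = X} = card {Y. Y \<subseteq> B \<and> s' ` Y = Y \<and> t' ` Y = Y}"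
proof -
  have inj: "inj_on f A" and surj: "f ` A = B" using f by (simp_all add: bij_betw_def)
  have eq: "s' ` f ` X = f ` X \<longleftrightarrow> s ` X = X"
    if X: "X \<subseteq> A" and s: "\<And>x. x \<in> A \<Longrightarrow> s x \<in> A" "\<And>x. x \<in> A \<Longrightarrow> f (s x) = s' (f x)" for s s' X
  proof -
    have "s' ` f ` X = f ` s ` X" unfolding image_image using X s(2) by (intro image_cong) auto
    moreover have "s ` X \<subseteq> A" using X s(1) by blast
    ultimately show ?thesis using inj_on_image_eq_iff[OF inj _ X] by simp
  qed
  have image: "(`) f ` {X. X \<subseteq> A \<and> s ` X = X \<and> t ` X = X} = {Y. Y \<subseteq> B \<and> s' ` Y = Y \<and> t' ` Y = Y}"
  proof (intro Set.set_eqI iffI)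
    fix Y assume "Y \<in> {Y. Y \<subseteq> B \<and> s' ` Y = Y \<and> t' ` Y = Y}"
    then have Y: "Y \<subseteq> B" "s' ` Y = Y" "t' ` Y = Y" by auto
    obtain X where X: "X \<subseteq> A" "Y = f ` X" using Y(1) surj by (auto simp: subset_image_iff)
    have "s ` X = X" using eq[where s = s and s' = s', OF X(1) s] Y(2) unfolding X(2) by (rule iffD1)
    moreover have "t ` X = X" using eq[where s = t and s' = t', OF X(1) t] Y(3) unfolding X(2) by (rule iffD1)
    ultimately show "Y \<in> (`) f ` {X. X \<subseteq> A \<and> s ` X = X \<and> t ` X = X}"
      unfolding X(2) using X(1) by (intro imageI CollectI conjI)
  next
    fix Y assume "Y \<in> (`) f ` {X. X \<subseteq> A \<and> s ` X = X \<and> t ` X = X}"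
    then obtain X where X: "X \<subseteq> A" "s ` X = X" "t ` X = X" "Y = f ` X" by blast
    have "s' ` Y = Y" using eq[where s = s and s' = s', OF X(1) s] X(2) unfolding X(4) by (rule iffD2)
    moreover have "t' ` Y = Y" using eq[where s = t and s' = t', OF X(1) t] X(3) unfolding X(4) by (rule iffD2)
    moreover have "Y \<subseteq> B" using X(1,4) surj by blast
    ultimately show "Y \<in> {Y. Y \<subseteq> B \<and> s' ` Y = Y \<and> t' ` Y = Y}" by simp
  qed
  have "inj_on ((`) f) {X. X \<subseteq> A \<and> s ` X = X \<and> t ` X = X}"
    by (rule inj_on_subset[OF inj_on_image_Pow[OF inj]]) blast
  then show ?thesis unfolding image[symmetric] by (rule card_image[symmetric])
qed

text \<open>Powers of a primitive root: on this logarithmic scale multiplication by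
  \<open>f i\<close> becomes the shift by \<open>i\<close> modulo \<open>p - 1\<close>.\<close>

lemma discrete_exponential:
  fixes p :: nat
  assumes p: "prime p"
  obtains f :: "int \<Rightarrow> int" where "bij_betw f {0..<int (p - 1)} {1..<int p}" "f 0 = 1"
    "\<And>x i. x \<in> {0..<int (p - 1)} \<Longrightarrow> i \<in> {0..<int (p - 1)} \<Longrightarrow>
      f ((x + i) mod int (p - 1)) = f i * f x mod int p"
proof -
  have p1: "p > 1" using p by (rule prime_gt_1_nat)
  obtain g where g: "residue_primroot p g" using prime_primitive_root_exists[of p] p p1 by auto
  define f where "f k = int (g ^ nat k mod p)" for k
  have tot: "totatives p = {0<..<p}" "totient p = p - 1"
    using p by (simp_all add: totatives_prime totient_prime)
  have "bij_betw (\<lambda>i. g ^ i mod p) {..<p - 1} {0<..<p}"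
    using residue_primroot_is_generator[OF p1 g] by (simp add: tot)
  moreover have "bij_betw nat {0..<int (p - 1)} {..<p - 1}"
    by (rule bij_betwI[where g = int]) auto
  moreover have "bij_betw int {0<..<p} {1..<int p}"
    by (rule bij_betwI[where g = nat]) auto
  ultimately have "bij_betw (int \<circ> ((\<lambda>i. g ^ i mod p) \<circ> nat)) {0..<int (p - 1)} {1..<int p}"
    by (intro bij_betw_trans)
  moreover have "int \<circ> ((\<lambda>i. g ^ i mod p) \<circ> nat) = f" by (auto simp: f_def)
  ultimately have bij: "bij_betw f {0..<int (p - 1)} {1..<int p}" by simp
  have "f ((x + i) mod int (p - 1)) = f i * f x mod int p"
    if x: "x \<in> {0..<int (p - 1)}" and i: "i \<in> {0..<int (p - 1)}" for x i
  proof -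
    have "coprime g p" using g by (simp add: residue_primroot_def coprime_commute)
    then have "[g ^ (p - 1) = 1] (mod p)" using euler_theorem[of g p] by (simp add: tot)
    moreover define m where "m = nat x + nat i"
    ultimately have "[(g ^ (p - 1)) ^ (m div (p - 1)) = 1 ^ (m div (p - 1))] (mod p)" by (intro cong_pow)
    then have "[(g ^ (p - 1)) ^ (m div (p - 1)) * g ^ (m mod (p - 1)) = 1 * g ^ (m mod (p - 1))] (mod p)"
      by (intro cong_mult) auto
    moreover have "(g ^ (p - 1)) ^ (m div (p - 1)) * g ^ (m mod (p - 1)) = g ^ m"
      by (simp add: power_mult[symmetric] power_add[symmetric])
    ultimately have red: "g ^ (m mod (p - 1)) mod p = g ^ m mod p" by (simp add: cong_def)
    have "x + i = int m" using x i by (simp add: m_def)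
    then have "nat ((x + i) mod int (p - 1)) = m mod (p - 1)" by (simp add: nat_mod_as_int)
    then have "f ((x + i) mod int (p - 1)) = int (g ^ m mod p)" by (simp only: f_def red)
    also have "\<dots> = int ((g ^ nat i mod p) * (g ^ nat x mod p) mod p)"
      by (simp add: m_def power_add mod_mult_eq mult.commute)
    also have "\<dots> = f i * f x mod int p" by (simp add: f_def zmod_int)
    finally show ?thesis .
  qed
  moreover have "f 0 = 1" using p1 by (simp add: f_def)
  ultimately show ?thesis using that bij by blast
qed

text \<open>Together with \<open>affine_invariant_sets\<close> this describes the fixed points of
  the affine map \<open>(a, b)\<close> on pairs: \<open>R\<close> sees only the multiplier,
  \<open>T\<close> the whole map.\<close>

definition invariant_symmetric_sets :: "int \<Rightarrow> int \<Rightarrow> int set set" where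
  "invariant_symmetric_sets p a =
    {R. R \<subseteq> {1..<p} \<and> (\<lambda>x. a * x mod p) ` R = R \<and> (\<lambda>x. - x mod p) ` R = R}"

definition affine_invariant_sets :: "int \<Rightarrow> int \<Rightarrow> int \<Rightarrow> int set set" where
  "affine_invariant_sets p a b = {T. T \<subseteq> {0..<p} \<and> (\<lambda>x. (a * x + b) mod p) ` T = T}"

locale discrete_exp =
  fixes p :: nat and f :: "int \<Rightarrow> int"
  assumes p: "prime p" and odd: "odd p"
    and bij: "bij_betw f {0..<int (p - 1)} {1..<int p}" and f0: "f 0 = 1"
    and hom: "\<And>x i. x \<in> {0..<int (p - 1)} \<Longrightarrow> i \<in> {0..<int (p - 1)} \<Longrightarrow>
      f ((x + i) mod int (p - 1)) = f i * f x mod int p"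
begin

lemma p2: "p > 2"
  using p odd by (metis even_numeral le_neq_implies_less prime_ge_2_nat)

text \<open>The square of this value is \<open>f 0 = 1\<close> while the value itself is not 1,
  which leaves only -1 modulo a prime. Negation thus becomes the shift by half of
  \<open>p - 1\<close>.\<close>

lemma f_half: "f (int ((p - 1) div 2)) = int p - 1"
proof -
  define h where "h = (p - 1) div 2"
  have h2: "h + h = p - 1" using odd by (auto simp: h_def elim!: oddE)
  have h: "int h \<in> {0..<int (p - 1)}" "int h \<noteq> 0" using h2 p2 by auto
  have z: "(0 :: int) \<in> {0..<int (p - 1)}" using p2 by simp
  have "(int h + int h) mod int (p - 1) = 0" by (simp only: of_nat_add[symmetric] h2 mod_self)
  then have sq: "f (int h) * f (int h) mod int p = 1" using hom[OF h(1) h(1)] by (simp add: f0)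
  have fh: "f (int h) \<in> {1..<int p}" using bij h(1) by (rule bij_betw_apply)
  have "f (int h) \<noteq> f 0"
    using inj_onD[OF bij_betw_imp_inj_on[OF bij] _ h(1) z] h(2) by blast
  then have ne: "f (int h) \<noteq> 1" by (simp add: f0)
  have "f (int h) * f (int h) mod int p = 1 mod int p" using sq p2 by simp
  then have "int p dvd f (int h) * f (int h) - 1" by (simp only: mod_eq_dvd_iff)
  then have "int p dvd (f (int h) - 1) * (f (int h) + 1)" by (simp add: algebra_simps)
  moreover have "prime (int p)" using p by simp
  ultimately have "int p dvd f (int h) - 1 \<or> int p dvd f (int h) + 1"
    by (simp only: prime_dvd_mult_iff)
  moreover have "\<not> int p dvd f (int h) - 1" using fh ne by (intro zdvd_not_zless) auto
  ultimately have "int p dvd f (int h) + 1" by blast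
  then have "int p \<le> f (int h) + 1" using fh by (intro zdvd_imp_le) auto
  then show ?thesis using fh by (simp add: h_def)
qed

lemma card_invariant_units:
  assumes i: "i < p - 1" and j: "j < p - 1"
  shows "card {R. R \<subseteq> {1..<int p} \<and> (\<lambda>x. f (int i) * x mod int p) ` R = R
      \<and> (\<lambda>x. f (int j) * x mod int p) ` R = R} = 2 ^ gcd (gcd i j) (p - 1)"
proof -
  have n: "p - 1 > 0" using p2 by simp
  have "card {X. X \<subseteq> {0..<int (p - 1)} \<and> (\<lambda>x. (x + int i) mod int (p - 1)) ` X = X
      \<and> (\<lambda>x. (x + int j) mod int (p - 1)) ` X = X} =
    card {R. R \<subseteq> {1..<int p} \<and> (\<lambda>x. f (int i) * x mod int p) ` R = R
      \<and> (\<lambda>x. f (int j) * x mod int p) ` R = R}"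
  proof (rule card_invariant_sets_bij_betw[OF bij])
    fix x assume x: "x \<in> {0..<int (p - 1)}"
    have "int i \<in> {0..<int (p - 1)}" "int j \<in> {0..<int (p - 1)}" using i j by simp_all
    then show "f ((x + int i) mod int (p - 1)) = f (int i) * f x mod int p"
      "f ((x + int j) mod int (p - 1)) = f (int j) * f x mod int p"
      using hom[OF x] by blast+
    show "(x + int i) mod int (p - 1) \<in> {0..<int (p - 1)}" "(x + int j) mod int (p - 1) \<in> {0..<int (p - 1)}"
      using n by simp_all
  qed
  then show ?thesis by (simp only: card_shift_invariant_sets[OF n])
qed

text \<open>Invariance under negation is invariance under multiplication by \<open>f h\<close> with
  \<open>2 h = p - 1\<close>, so the exponent is the gcd of \<open>i\<close>, \<open>h\<close> and
  \<open>2 h\<close>, which is half of \<open>gcd (2 * i) (2 * h)\<close>.\<close>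

lemma card_invariant_symmetric_sets:
  assumes i: "i < p - 1"
  shows "card (invariant_symmetric_sets (int p) (f (int i))) = 2 ^ (gcd (2 * i) (p - 1) div 2)"
proof -
  define h where "h = (p - 1) div 2"
  have h2: "p - 1 = 2 * h" using odd by (auto simp: h_def elim!: oddE)
  have "h < p - 1" using h2 p2 by simp
  have "(\<lambda>x. f (int h) * x mod int p) = (\<lambda>x. - x mod int p)"
  proof
    show "f (int h) * x mod int p = - x mod int p" for x
      unfolding h_def f_half by (simp add: mod_eq_dvd_iff algebra_simps)
  qed
  then have "card (invariant_symmetric_sets (int p) (f (int i))) = 2 ^ gcd (gcd i h) (p - 1)"
    using card_invariant_units[OF i \<open>h < p - 1\<close>] by (simp only: invariant_symmetric_sets_def)
  also have "gcd (gcd i h) (p - 1) = gcd i h"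
    unfolding h2 by (simp add: gcd_nat.absorb1 dvd_mult)
  also have "gcd i h = gcd (2 * i) (p - 1) div 2" unfolding h2 by (simp add: gcd_mult_distrib_nat[symmetric])
  finally show ?thesis .
qed

text \<open>The residue 0 is fixed by every multiplication, so whether it belongs to the set is a
  free choice; this is the leading factor 2.\<close>

lemma card_linear_invariant_sets:
  assumes i: "i < p - 1"
  shows "card (affine_invariant_sets (int p) (f (int i)) 0) = 2 * 2 ^ gcd i (p - 1)"
proof -
  define a where "a = f (int i)"
  define F where "F = {T. T \<subseteq> {1..<int p} \<and> (\<lambda>x. a * x mod int p) ` T = T}"
  have z: "0 < p - 1" using p2 by simp
  \<comment> \<open>\<open>card_invariant_units\<close> takes two multipliers; the second is filled
    with \<open>f 0 = 1\<close>, which imposes no condition.\<close>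
  have "f (int 0) = 1" using f0 by simp
  have id: "(\<lambda>x. f (int 0) * x mod int p) ` T = T" if "T \<subseteq> {1..<int p}" for T
  proof -
    have "(\<lambda>x. f (int 0) * x mod int p) ` T = (\<lambda>x. x) ` T"
      using that \<open>f (int 0) = 1\<close> by (intro image_cong) auto
    then show ?thesis by simp
  qed
  have "F = {R. R \<subseteq> {1..<int p} \<and> (\<lambda>x. f (int i) * x mod int p) ` R = R
      \<and> (\<lambda>x. f (int 0) * x mod int p) ` R = R}"
    unfolding F_def a_def using id by blast
  then have card_F: "card F = 2 ^ gcd i (p - 1)" using card_invariant_units[OF i z] by simp
  have "a \<in> {1..<int p}" unfolding a_def using bij by (rule bij_betw_apply) (use i in simp)
  have bij_a: "bij_betw (\<lambda>x. a * x mod int p) {1..<int p} {1..<int p}"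
    using p \<open>a \<in> {1..<int p}\<close> by (intro residue_multiple_bij_betw) auto
  have F_iff: "T - {0} \<in> F \<longleftrightarrow> (\<lambda>x. a * x mod int p) ` T = T" if T: "T \<subseteq> {0..<int p}" for T
  proof -
    have sub: "T - {0} \<subseteq> {1..<int p}" using T by (auto simp: subset_iff order_le_less)
    then have nz: "0 \<notin> (\<lambda>x. a * x mod int p) ` (T - {0})"
      using bij_betw_apply[OF bij_a] by fastforce
    have img: "(\<lambda>x. a * x mod int p) ` T =
        (\<lambda>x. a * x mod int p) ` (T - {0}) \<union> (if 0 \<in> T then {0} else {})" by force
    have "B = T - {0} \<longleftrightarrow> B \<union> (if 0 \<in> T then {0} else {}) = T" if "0 \<notin> B" for B
      using that by (cases "0 \<in> T") auto
    from this[OF nz] show ?thesis using sub by (simp only: F_def img mem_Collect_eq simp_thms)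
  qed
  have "affine_invariant_sets (int p) a 0 = F \<union> insert 0 ` F"
  proof (intro Set.set_eqI iffI)
    fix T assume "T \<in> affine_invariant_sets (int p) a 0"
    then have T: "T \<subseteq> {0..<int p}" "(\<lambda>x. a * x mod int p) ` T = T"
      by (auto simp: affine_invariant_sets_def)
    then have F: "T - {0} \<in> F" using F_iff by blast
    show "T \<in> F \<union> insert 0 ` F"
    proof (cases "0 \<in> T")
      case True
      then have "T = insert 0 (T - {0})" by blast
      then show ?thesis using F by (intro UnI2) (rule image_eqI)
    next
      case False
      then have "T - {0} = T" by simp
      then show ?thesis using F by simp
    qed
  next
    fix T assume "T \<in> F \<union> insert 0 ` F"
    then obtain T' where T': "T' \<in> F" "T = T' \<or> T = insert 0 T'" by blast
    have sub: "T' \<subseteq> {1..<int p}" using T'(1) by (simp add: F_def)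
    then have "T' - {0} = T'" "T - {0} = T'" using T'(2) by auto
    moreover have "T \<subseteq> {0..<int p}" using sub T'(2) p2 by (auto simp: subset_iff)
    ultimately show "T \<in> affine_invariant_sets (int p) a 0"
      using F_iff[of T] T'(1) by (simp add: affine_invariant_sets_def)
  qed
  moreover have "F \<inter> insert 0 ` F = {}" by (auto simp: F_def)
  moreover have "inj_on (insert 0) F"
  proof (rule inj_onI)
    fix X Y assume XY: "X \<in> F" "Y \<in> F" "insert 0 X = insert 0 Y"
    then have "0 \<notin> X" "0 \<notin> Y" by (auto simp: F_def)
    then show "X = Y" using XY(3) by (simp add: insert_ident)
  qed
  moreover have "finite F" by (rule finite_subset[of _ "Pow {1..<int p}"]) (auto simp: F_def)
  ultimately show ?thesis using card_F by (simp add: card_Un_disjoint card_image a_def)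
qed

text \<open>For \<open>a \<noteq> 1\<close> the map \<open>x \<mapsto> a x + b\<close> has the fixed
  residue \<open>c = b / (1 - a)\<close>, and translation by \<open>c\<close> conjugates
  multiplication by \<open>a\<close> into it.\<close>

lemma card_affine_invariant_sets:
  assumes a: "a \<in> {1..<int p}" "a \<noteq> 1"
  shows "card (affine_invariant_sets (int p) a b) = card (affine_invariant_sets (int p) a 0)"
proof -
  have p': "prime (int p)" using p by simp
  have p0: "int p > 0" using p2 by simp
  have "\<not> int p dvd 1 - a"
  proof
    assume "int p dvd 1 - a"
    then have "int p dvd a - 1" by (simp add: dvd_diff_commute)
    then show False using a zdvd_not_zless[of "a - 1" "int p"] by simp
  qed
  then have "coprime (1 - a) (int p)" using prime_imp_coprime[OF p'] coprime_commute by blast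
  then obtain e where e: "[(1 - a) * e = 1] (mod int p)" by (auto dest: cong_solve_coprime_int)
  define c where "c = e * b"
  have "[(1 - a) * e * b = 1 * b] (mod int p)" using e by (rule cong_scalar_right)
  then have "[a * c + (1 - a) * e * b = a * c + b] (mod int p)" by (intro cong_add) auto
  then have c: "[c = a * c + b] (mod int p)" by (simp add: c_def algebra_simps)
  have "bij_betw (\<lambda>x. (1 * x + c) mod int p) {0..<int p} {0..<int p}"
    using p2 by (intro affine_bij_betw_residues[OF p']) auto
  then have "card {X. X \<subseteq> {0..<int p} \<and> (\<lambda>x. (a * x + 0) mod int p) ` X = X \<and> (\<lambda>x. (a * x + 0) mod int p) ` X = X}
    = card {X. X \<subseteq> {0..<int p} \<and> (\<lambda>x. (a * x + b) mod int p) ` X = X \<and> (\<lambda>x. (a * x + b) mod int p) ` X = X}"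
  proof (rule card_invariant_sets_bij_betw)
    show "(a * x + 0) mod int p \<in> {0..<int p}" for x using p0 by simp
    show "(1 * ((a * x + 0) mod int p) + c) mod int p = (a * ((1 * x + c) mod int p) + b) mod int p" for x
    proof -
      have "[(a * x + 0) mod int p + c = a * x + (a * c + b)] (mod int p)"
        using c by (intro cong_add) (auto simp: cong_def)
      moreover have "[a * ((1 * x + c) mod int p) + b = a * (x + c) + b] (mod int p)"
        by (intro cong_add cong_mult) (auto simp: cong_def)
      ultimately show ?thesis by (simp add: cong_def algebra_simps)
    qed
    then show "(1 * ((a * x + 0) mod int p) + c) mod int p = (a * ((1 * x + c) mod int p) + b) mod int p" for x .
    show "(a * x + 0) mod int p \<in> {0..<int p}" for x using p0 by simp
  qed
  then show ?thesis unfolding affine_invariant_sets_def conj_absorb by (rule sym)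
qed

text \<open>A nonzero translation is transitive on the residues, so only the empty and the full set
  survive.\<close>

lemma card_translation_invariant_sets:
  assumes b: "b \<in> {1..<int p}"
  shows "card (affine_invariant_sets (int p) 1 b) = 2"
proof -
  have p': "prime (int p)" using p by simp
  have bij_b: "bij_betw (\<lambda>x. (1 * x + b) mod int p) {0..<int p} {0..<int p}"
    using p2 by (intro affine_bij_betw_residues[OF p']) auto
  note surj = bij_betw_imp_surj_on[OF bij_b] and inj = bij_betw_imp_inj_on[OF bij_b]
  have "affine_invariant_sets (int p) 1 b = {{}, {0..<int p}}"
  proof (intro Set.set_eqI iffI)
    fix T assume "T \<in> affine_invariant_sets (int p) 1 b"
    then have T: "T \<subseteq> {0..<int p}" "(\<lambda>x. (1 * x + b) mod int p) ` T = T"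
      by (auto simp: affine_invariant_sets_def)
    have "\<not> int p dvd b" using b by (intro zdvd_not_zless) auto
    moreover have "x \<in> T \<longleftrightarrow> (x + b) mod int p \<in> T" if "x \<in> {0..<int p}" for x
      using inj_on_image_mem_iff[OF inj that T(1)] unfolding T(2) by simp
    ultimately have "T = {} \<or> T = {0..<int p}"
      using shift_invariant_residues_trivial[OF p' _ T(1)] by blast
    then show "T \<in> {{}, {0..<int p}}" by simp
  next
    fix T assume "T \<in> {{}, {0..<int p}}"
    then show "T \<in> affine_invariant_sets (int p) 1 b"
      unfolding affine_invariant_sets_def using surj by auto
  qed
  then show ?thesis using p2 by simp
qed

end

section \<open>Orbits of the affine group\<close>

text \<open>Elements of \<open>BijGroup\<close> are extensional functions, hence the
  \<open>restrict\<close>; bijectivity comes from the action of the inverse.\<close>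

lemma (in group) group_actionI:
  assumes closed: "\<And>g x. g \<in> carrier G \<Longrightarrow> x \<in> E \<Longrightarrow> act g x \<in> E"
    and mult: "\<And>g h x. g \<in> carrier G \<Longrightarrow> h \<in> carrier G \<Longrightarrow> x \<in> E \<Longrightarrow> act (g \<otimes> h) x = act g (act h x)"
    and one: "\<And>x. x \<in> E \<Longrightarrow> act \<one> x = x"
  shows "group_action G E (\<lambda>g. restrict (act g) E)"
proof -
  have Bij: "restrict (act g) E \<in> Bij E" if g: "g \<in> carrier G" for g
  proof -
    have "bij_betw (act g) E E"
    proof (rule bij_betwI[where g = "act (inv g)"])
      show "act g \<in> E \<rightarrow> E" "act (inv g) \<in> E \<rightarrow> E" using closed g by auto
      show "act (inv g) (act g x) = x" if "x \<in> E" for x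
        using mult[of "inv g" g x] g that one by simp
      show "act g (act (inv g) x) = x" if "x \<in> E" for x
        using mult[of g "inv g" x] g that one by simp
    qed
    then have "bij_betw (restrict (act g) E) E E" by (simp add: bij_betw_restrict_eq)
    then show ?thesis by (simp add: Bij_def)
  qed
  have "(\<lambda>g. restrict (act g) E) \<in> hom G (BijGroup E)"
  proof (rule homI)
    show "restrict (act g) E \<in> carrier (BijGroup E)" if "g \<in> carrier G" for g
      using Bij[OF that] by (simp add: BijGroup_def)
    show "restrict (act (g \<otimes> h)) E = restrict (act g) E \<otimes>\<^bsub>BijGroup E\<^esub> restrict (act h) E"
      if "g \<in> carrier G" "h \<in> carrier G" for g h
      using that Bij closed mult by (auto simp: BijGroup_def compose_def fun_eq_iff)
  qed
  then show ?thesis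
    by (simp add: group_action_def group_hom_def group_hom_axioms_def group_BijGroup is_group)
qed

text \<open>The pair \<open>(a, b)\<close> stands for \<open>x \<mapsto> a x + b\<close> and
  multiplication is composition; for an odd prime \<open>p\<close> this is a copy of the
  automorphism group of the dihedral group.\<close>

definition affine_group :: "int \<Rightarrow> (int \<times> int) monoid" where
  "affine_group p =
    \<lparr>carrier = {1..<p} \<times> {0..<p},
     mult = (\<lambda>(a, b) (c, d). (a * c mod p, (a * d + b) mod p)),
     one = (1, 0)\<rparr>"

lemma mult_mod_in_units:
  fixes p :: int
  assumes "prime p" "a \<in> {1..<p}" "c \<in> {1..<p}"
  shows "a * c mod p \<in> {1..<p}"
  using residue_multiple_bij_betw[OF assms(1,2)] assms(3) by (rule bij_betw_apply)

lemma mod_inner_left: "(a mod p * x + b mod p) mod p = (a * x + b) mod (p :: int)"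
  by (metis mod_add_eq mod_mult_left_eq mod_mod_trivial)

lemma group_affine_group:
  fixes p :: int
  assumes p: "prime p"
  shows "group (affine_group p)"
proof (rule groupI)
  have p1: "p > 1" using p by (rule prime_gt_1_int)
  show "\<one>\<^bsub>affine_group p\<^esub> \<in> carrier (affine_group p)" using p1 by (simp add: affine_group_def)
  fix x assume x: "x \<in> carrier (affine_group p)"
  obtain a b where ab: "x = (a, b)" by force
  have a: "a \<in> {1..<p}" and b: "b \<in> {0..<p}" using x by (simp_all add: affine_group_def ab)
  show "\<one>\<^bsub>affine_group p\<^esub> \<otimes>\<^bsub>affine_group p\<^esub> x = x" using a b by (simp add: affine_group_def ab)
  show "\<exists>y\<in>carrier (affine_group p). y \<otimes>\<^bsub>affine_group p\<^esub> x = \<one>\<^bsub>affine_group p\<^esub>"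
  proof -
    have "1 \<in> (\<lambda>y. a * y mod p) ` {1..<p}"
      using bij_betw_imp_surj_on[OF residue_multiple_bij_betw[OF p a]] p1 by simp
    then obtain e where e: "e \<in> {1..<p}" "a * e mod p = 1" by auto
    have "(e, - (e * b) mod p) \<otimes>\<^bsub>affine_group p\<^esub> x = \<one>\<^bsub>affine_group p\<^esub>"
      using e(2) by (simp add: affine_group_def ab mod_simps mult.commute)
    moreover have "(e, - (e * b) mod p) \<in> carrier (affine_group p)"
      using e(1) p1 by (simp add: affine_group_def)
    ultimately show ?thesis by blast
  qed
  fix y assume y: "y \<in> carrier (affine_group p)"
  obtain c d where cd: "y = (c, d)" by force
  have c: "c \<in> {1..<p}" using y by (simp add: affine_group_def cd)
  show "x \<otimes>\<^bsub>affine_group p\<^esub> y \<in> carrier (affine_group p)"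
    using mult_mod_in_units[OF p a c] p1 by (simp add: affine_group_def ab cd)
  fix z assume z: "z \<in> carrier (affine_group p)"
  obtain k l where kl: "z = (k, l)" by force
  have "(a * c mod p * l + (a * d + b) mod p) mod p = (a * ((c * l + d) mod p) + b) mod p"
    unfolding mod_inner_left mod_inner_right by (simp add: algebra_simps)
  then show "x \<otimes>\<^bsub>affine_group p\<^esub> y \<otimes>\<^bsub>affine_group p\<^esub> z
      = x \<otimes>\<^bsub>affine_group p\<^esub> (y \<otimes>\<^bsub>affine_group p\<^esub> z)"
    by (simp add: affine_group_def ab cd kl mod_simps mult.assoc)
qed

lemma affine_image_mult:
  "affine_image p (g \<otimes>\<^bsub>affine_group p\<^esub> h) X = affine_image p g (affine_image p h X)"
proof -
  obtain a b c d R T where eqs: "g = (a, b)" "h = (c, d)" "X = (R, T)" by (metis surj_pair)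
  have "a * c mod p * x mod p = a * (c * x mod p) mod p" for x
    by (simp add: mod_simps mult.assoc)
  moreover have "(a * c mod p * x + (a * d + b) mod p) mod p = (a * ((c * x + d) mod p) + b) mod p" for x
    unfolding mod_inner_left mod_inner_right by (simp add: algebra_simps)
  ultimately show ?thesis by (simp add: affine_image_def affine_group_def eqs image_image)
qed

lemma affine_image_one:
  assumes "X \<in> dihedral_sets p"
  shows "affine_image p (1, 0) X = X"
proof -
  have id: "(\<lambda>x. x mod p) ` Q = Q" if "Q \<subseteq> {0..<p}" for Q
  proof -
    have "(\<lambda>x. x mod p) ` Q = (\<lambda>x. x) ` Q" using that by (intro image_cong) auto
    then show ?thesis by simp
  qed
  obtain R T where X: "X = (R, T)" by force
  have "R \<subseteq> {0..<p}" "T \<subseteq> {0..<p}" using assms by (auto simp: X dihedral_sets_def)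
  then show ?thesis by (simp add: X affine_image_def id)
qed

lemma affine_image_closed:
  fixes p :: int
  assumes p: "prime p" and g: "g \<in> carrier (affine_group p)" and X: "X \<in> dihedral_sets p"
  shows "affine_image p g X \<in> dihedral_sets p"
proof -
  obtain a b where ab: "g = (a, b)" by force
  have a: "a \<in> {1..<p}" using g by (simp add: ab affine_group_def)
  have p0: "p > 0" using p by (rule prime_gt_0_int)
  obtain R T where RT: "X = (R, T)" by force
  have R: "R \<subseteq> {1..<p}" "(\<lambda>x. - x mod p) ` R = R" using X by (auto simp: RT dihedral_sets_def)
  have "(\<lambda>x. a * x mod p) ` R \<subseteq> {1..<p}" using mult_mod_in_units[OF p a] R(1) by blast
  moreover have "(\<lambda>x. - x mod p) ` (\<lambda>x. a * x mod p) ` R = (\<lambda>x. a * x mod p) ` R"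
  proof -
    have "(\<lambda>x. - x mod p) ` (\<lambda>x. a * x mod p) ` R = (\<lambda>x. a * x mod p) ` (\<lambda>x. - x mod p) ` R"
      unfolding image_image by (intro image_cong) (simp_all add: mod_simps)
    then show ?thesis using R(2) by simp
  qed
  moreover have "(\<lambda>x. (a * x + b) mod p) ` T \<subseteq> {0..<p}" using p0 by auto
  ultimately show ?thesis by (simp add: RT ab affine_image_def dihedral_sets_def)
qed

lemma dihedral_sets_finite: "finite (dihedral_sets p)"
  by (rule finite_subset[of _ "Pow {1..<p} \<times> Pow {0..<p}"]) (auto simp: dihedral_sets_def)

text \<open>By the affine criterion the orbits on \<open>dihedral_sets\<close> are exactly the
  isomorphism classes, and being fixed by \<open>(a, b)\<close> splits into independent conditions
  on \<open>R\<close> and \<open>T\<close>.\<close>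

lemma card_graph_classes_burnside:
  fixes p :: nat
  assumes p: "prime p" and odd: "odd p"
  shows "card (dihedral_sets (int p) // graph_iso_rel (int p)) * ((p - 1) * p) =
    (\<Sum>a\<in>{1..<int p}. \<Sum>b\<in>{0..<int p}.
      card (invariant_symmetric_sets (int p) a) * card (affine_invariant_sets (int p) a b))"
proof -
  let ?G = "affine_group (int p)" and ?E = "dihedral_sets (int p)"
  let ?act = "\<lambda>g. restrict (affine_image (int p) g) ?E"
  have p': "prime (int p)" using p by simp
  interpret group ?G using p' by (rule group_affine_group)
  interpret group_action ?G ?E ?act
    using affine_image_closed[OF p'] affine_image_mult affine_image_one
    by (intro group_actionI) (auto simp: affine_group_def)
  have carrier: "carrier ?G = {1..<int p} \<times> {0..<int p}" by (simp add: affine_group_def)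
  have orbits: "orbits ?G ?E ?act = ?E // graph_iso_rel (int p)"
  proof -
    have "orbit ?G ?act X = graph_iso_rel (int p) `` {X}" if X: "X \<in> ?E" for X
    proof (intro Set.set_eqI)
      fix Y :: "int set \<times> int set"
      obtain R T R' T' where XY: "X = (R, T)" "Y = (R', T')" by force
      have "Y \<in> orbit ?G ?act X \<longleftrightarrow> (\<exists>g\<in>carrier ?G. Y = affine_image (int p) g X)"
        using X by (auto simp: Group_Action.orbit_def)
      also have "\<dots> \<longleftrightarrow> Y \<in> ?E \<and> (\<exists>g\<in>carrier ?G. Y = affine_image (int p) g X)"
        using affine_image_closed[OF p' _ X] by blast
      also have "\<dots> \<longleftrightarrow> Y \<in> ?E \<and> graph_isomorphic (int p) X Y"
      proof (rule conj_cong[OF refl])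
        assume "Y \<in> ?E"
        then have "R \<subseteq> {1..<int p}" "R' \<subseteq> {1..<int p}" "T \<subseteq> {0..<int p}" "T' \<subseteq> {0..<int p}"
          using X by (simp_all add: XY dihedral_sets_def)
        from graph_isomorphic_iff_affine[OF p odd this]
        show "(\<exists>g\<in>carrier ?G. Y = affine_image (int p) g X) \<longleftrightarrow> graph_isomorphic (int p) X Y"
          unfolding carrier XY by blast
      qed
      finally show "Y \<in> orbit ?G ?act X \<longleftrightarrow> Y \<in> graph_iso_rel (int p) `` {X}"
        using X by (simp add: graph_iso_rel_def)
    qed
    then show ?thesis unfolding orbits_def quotient_def by blast
  qed
  have order: "order ?G = (p - 1) * p"
    using prime_gt_0_nat[OF p] by (simp add: order_def carrier card_cartesian_product nat_diff_distrib)
  have fixed: "card (invariants ?E ?act (a, b)) =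
      card (invariant_symmetric_sets (int p) a) * card (affine_invariant_sets (int p) a b)" for a b
  proof -
    have "invariants ?E ?act (a, b) = invariant_symmetric_sets (int p) a \<times> affine_invariant_sets (int p) a b"
      by (auto simp: invariants_def invariant_symmetric_sets_def affine_invariant_sets_def
          dihedral_sets_def affine_image_def)
    then show ?thesis by (simp add: card_cartesian_product)
  qed
  have "card (?E // graph_iso_rel (int p)) * ((p - 1) * p) =
      (\<Sum>g\<in>carrier ?G. card (invariants ?E ?act g))"
    using burnside[OF _ dihedral_sets_finite] unfolding orbits order carrier by simp
  also have "\<dots> = (\<Sum>(a, b)\<in>{1..<int p} \<times> {0..<int p}.
      card (invariant_symmetric_sets (int p) a) * card (affine_invariant_sets (int p) a b))"
    unfolding carrier by (intro sum.cong refl) (simp add: split_paired_all fixed)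
  finally show ?thesis by (simp only: sum.cartesian_product)
qed

theorem theorem4p3:
  fixes p :: nat
  assumes "prime p" and "odd p"
  shows "real (card (cayley_graphs (dihedral_group p) // cayley_iso (dihedral_group p))) =
    1 / real p * (2 ^ ((p + 1) div 2) - 2 ^ ((3 * p - 1) div 2))
    + 2 / (real p - 1) * (\<Sum>i = 0..p - 2. 2 ^ (gcd (2 * i) (p - 1) div 2 + gcd i (p - 1)))"
proof -
  obtain f where f: "bij_betw f {0..<int (p - 1)} {1..<int p}" "f 0 = 1"
    "\<And>x i. x \<in> {0..<int (p - 1)} \<Longrightarrow> i \<in> {0..<int (p - 1)} \<Longrightarrow>
      f ((x + i) mod int (p - 1)) = f i * f x mod int p"
    using discrete_exponential[OF assms(1)] by blast
  interpret discrete_exp p f by unfold_locales (fact assms f)+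
  define h where "h = (p - 1) div 2"
  have ph: "p = 2 * h + 1" using odd by (auto simp: h_def elim!: oddE)
  define cA where "cA a = real (card (invariant_symmetric_sets (int p) a))" for a
  define cB where "cB a b = real (card (affine_invariant_sets (int p) a b))" for a b
  define N where "N = real (card (dihedral_sets (int p) // graph_iso_rel (int p)))"
  define S where "S = (\<Sum>i = 0..p - 2. 2 ^ (gcd (2 * i) (p - 1) div 2 + gcd i (p - 1)) :: real)"
  have cA1: "cA 1 = 2 ^ h"
    using card_invariant_symmetric_sets[of 0] p2 f(2) by (simp add: cA_def h_def)
  have cB1: "cB 1 0 = 2 ^ p"
    using card_linear_invariant_sets[of 0] p2 f(2) by (simp add: cB_def power_Suc[symmetric] del: power_Suc)
  have sum_b: "(\<Sum>b\<in>{0..<int p}. cA a * cB a b) = real p * (cA a * cB a 0)" if "a \<in> {1..<int p}" "a \<noteq> 1" for a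
  proof -
    have "cB a b = cB a 0" for b
      unfolding cB_def by (rule arg_cong[OF card_affine_invariant_sets[OF that]])
    then have "(\<Sum>b\<in>{0..<int p}. cA a * cB a b) = (\<Sum>b\<in>{0..<int p}. cA a * cB a 0)"
      by (intro sum.cong refl arg_cong[where f = "(*) (cA a)"])
    then show ?thesis by simp
  qed
  \<comment> \<open>For \<open>a = 1\<close> the value \<open>b = 0\<close> is the identity, and
    each of the other \<open>p - 1\<close> translations contributes 2.\<close>
  have sum_b1: "(\<Sum>b\<in>{0..<int p}. cA 1 * cB 1 b) = cA 1 * (cB 1 0 + 2 * (real p - 1))"
  proof -
    have "{0..<int p} = insert 0 {1..<int p}" using p2 by auto
    then have "(\<Sum>b\<in>{0..<int p}. cB 1 b) = cB 1 0 + (\<Sum>b\<in>{1..<int p}. cB 1 b)" by simp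
    also have "(\<Sum>b\<in>{1..<int p}. cB 1 b) = (\<Sum>b\<in>{1..<int p}. 2)"
      using card_translation_invariant_sets by (intro sum.cong) (simp_all add: cB_def)
    also have "\<dots> = 2 * (real p - 1)" using p2 by simp
    finally show ?thesis by (simp add: sum_distrib_left[symmetric])
  qed
  have units: "{1..<int p} = insert 1 {2..<int p}" using p2 by auto
  \<comment> \<open>The multipliers are enumerated by their exponents \<open>i\<close>, which is how
    the gcds appear; the factor 2 is the one of \<open>card_linear_invariant_sets\<close>.\<close>
  have sum_units: "(\<Sum>a\<in>{1..<int p}. cA a * cB a 0) = 2 * S"
  proof -
    have "(\<Sum>a\<in>{1..<int p}. cA a * cB a 0) = (\<Sum>i\<in>{0..<int (p - 1)}. cA (f i) * cB (f i) 0)"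
      using f(1) by (rule sum.reindex_bij_betw[symmetric])
    also have "\<dots> = (\<Sum>i\<in>{0..<p - 1}. cA (f (int i)) * cB (f (int i)) 0)"
      by (rule sum.reindex_bij_betw[symmetric], rule bij_betwI[where g = nat]) auto
    also have "\<dots> = (\<Sum>i\<in>{0..<p - 1}. 2 * 2 ^ (gcd (2 * i) (p - 1) div 2 + gcd i (p - 1)))"
      by (intro sum.cong)
        (simp_all add: cA_def cB_def card_invariant_symmetric_sets card_linear_invariant_sets power_add)
    also have "{0..<p - 1} = {0..p - 2}" using p2 by auto
    finally show ?thesis by (simp add: S_def sum_distrib_left)
  qed
  have "N * ((real p - 1) * real p) = (\<Sum>a\<in>{1..<int p}. \<Sum>b\<in>{0..<int p}. cA a * cB a b)"
    using arg_cong[OF card_graph_classes_burnside[OF assms], of real] p2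
    by (simp add: N_def cA_def cB_def of_nat_diff)
  also have "\<dots> = cA 1 * (cB 1 0 + 2 * (real p - 1)) + (\<Sum>a\<in>{2..<int p}. real p * (cA a * cB a 0))"
    unfolding units by (simp add: sum_b sum_b1)
  \<comment> \<open>\<open>S\<close> includes the multiplier 1, at exponent 0, so its term is taken
    out again.\<close>
  also have "(\<Sum>a\<in>{2..<int p}. real p * (cA a * cB a 0)) = real p * (2 * S - cA 1 * cB 1 0)"
    using sum_units unfolding units by (simp add: sum_distrib_left[symmetric])
  \<comment> \<open>The multiplier 1 contributes \<open>2 ^ p + 2 * (p - 1)\<close> times
    \<open>cA 1\<close> instead of the uniform \<open>p * 2 ^ p\<close> times \<open>cA 1\<close>;
    the difference has the factor \<open>p - 1\<close>, which cancels on division.\<close>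
  finally have "N * ((real p - 1) * real p) =
      (real p - 1) * (2 ^ h * (2 - 2 ^ p)) + real p * (2 * S)"
    by (simp add: cA1 cB1 algebra_simps)
  then have "N = 1 / real p * (2 ^ h * (2 - 2 ^ p)) + 2 / (real p - 1) * S"
    using p2 by (simp add: field_simps)
  moreover have "2 ^ h * (2 - 2 ^ p) = (2 ^ ((p + 1) div 2) - 2 ^ ((3 * p - 1) div 2) :: real)"
  proof -
    have "(p + 1) div 2 = h + 1" "(3 * p - 1) div 2 = h + p" using ph by simp_all
    then show ?thesis by (simp add: power_add right_diff_distrib)
  qed
  moreover have "card (cayley_graphs (dihedral_group p) // cayley_iso (dihedral_group p))
      = card (dihedral_sets (int p) // graph_iso_rel (int p))"
    using p2 by (intro card_dihedral_cayley_graph_classes) simp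
  ultimately show ?thesis by (simp add: N_def S_def)
qed

end
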